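(* Let $N\ge1$, $1\le p<\infty$, $0<s<1$, and let $q$ satisfy $q\ge p$ together with $q\le p^*_s$ if $s\,p<N$, $q<\infty$ if $s\,p=N$, $q\le\infty$ if $s\,p>N$. There exists a constant $W=W(N,p,s,q,R/r)>0$ such that for every $x_0\in\mathbb{R}^N$, $r>0$, $R>\sqrt N\,r$ and every $u\in C^\infty_0(\mathbb{R}^N)$ $$\|u-\mathrm{av}(u;B_r(x_0))\|^p_{L^q(B_r(x_0))}\le W\,\frac{R^{s\,p-N+N\frac pq}}{s\,(1-s)\,\lambda^s_{p,q}(B_1)}\,s\,(1-s)\iint_{B_R(x_0)\times\mathbb{R}^N}\frac{|u(x)-u(y)|^p}{|x-y|^{N+s\,p}}\,dx\,dy.$$ More precisely, we have $$0<\lim_{s\to0}W<\infty,\qquad0<\lim_{s\to1}W<\infty,$$ and $$0<\lim_{R/r\to\sqrt N}\left(\frac Rr-\sqrt N\right)^{s\,p}W\left(N,p,s,q,\frac Rr\right)<\infty,\qquad0<\lim_{R/r\to\infty}W\left(N,p,s,q,\frac Rr\right)<\infty.$$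
   Context: $p^*_s=\frac{Np}{N-sp}$ if $sp<N$. $B_r(x_0)$ is the open ball of centre $x_0$ and radius $r$ in $\mathbb{R}^N$, $B_r=B_r(0)$; $\mathrm{av}(u;E)=\frac1{|E|}\int_Eu\,dx$; $p/q=0$ if $q=\infty$. For an open set $\Omega\subseteq\mathbb{R}^N$, $$\lambda^s_{p,q}(\Omega)=\inf_{u\in C^\infty_0(\Omega)}\left\{\iint_{\mathbb{R}^N\times\mathbb{R}^N}\frac{|u(x)-u(y)|^p}{|x-y|^{N+sp}}\,dx\,dy:\ \|u\|_{L^q(\Omega)}=1\right\}.$$ In the limits in $s$, the exponents are always subject to the stated constraint on $q$. *)

theory Defs
  imports "HOL-Analysis.Analysis" "HOL-Probability.Essential_Supremum"
begin

fun Ck :: "nat \<Rightarrow> ('a::euclidean_space \<Rightarrow> real) \<Rightarrow> bool" where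
  "Ck 0 f = continuous_on UNIV f"
| "Ck (Suc k) f = ((\<forall>x. f differentiable (at x)) \<and>
     (\<forall>v. Ck k (\<lambda>x. frechet_derivative f (at x) v)))"

text \<open>The space of smooth functions with compact support in an open set; such functions are
  regarded as defined on the whole space (extended by zero).\<close>

definition test_functions :: "'a::euclidean_space set \<Rightarrow> ('a \<Rightarrow> real) set" where
  "test_functions \<Omega> = {u. (\<forall>k. Ck k u) \<and> compact (closure {x. u x \<noteq> 0}) \<and>
     closure {x. u x \<noteq> 0} \<subseteq> \<Omega>}"

text \<open>Power of an extended nonnegative number, only used with exponents \<open>a > 0\<close>.\<close>

definition ennpowr :: "ennreal \<Rightarrow> real \<Rightarrow> ennreal" where
  "ennpowr x a = (if x = \<infinity> then \<infinity> else ennreal (enn2real x powr a))"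

definition Lq_norm :: "ennreal \<Rightarrow> 'a::euclidean_space set \<Rightarrow> ('a \<Rightarrow> real) \<Rightarrow> ennreal" where
  "Lq_norm q E u =
     (if q = \<infinity> then esssup (restrict_space lborel E) (\<lambda>x. ennreal \<bar>u x\<bar>)
      else ennpowr (\<integral>\<^sup>+x\<in>E. ennreal (\<bar>u x\<bar> powr enn2real q) \<partial>lborel) (1 / enn2real q))"

definition av :: "('a::euclidean_space \<Rightarrow> real) \<Rightarrow> 'a set \<Rightarrow> real" where
  "av u E = (1 / measure lborel E) * (LINT x:E|lborel. u x)"

text \<open>The double integral over \<open>A \<times> B\<close> of \<open>|u x - u y|^p / |x - y|^(N + s p)\<close>.\<close>

definition gagliardo ::
    "real \<Rightarrow> real \<Rightarrow> 'a::euclidean_space set \<Rightarrow> 'a set \<Rightarrow> ('a \<Rightarrow> real) \<Rightarrow> ennreal" where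
  "gagliardo s p A B u =
     (\<integral>\<^sup>+z\<in>A \<times> B. ennreal (\<bar>u (fst z) - u (snd z)\<bar> powr p /
        norm (fst z - snd z) powr (real DIM('a) + s * p)) \<partial>(lborel \<Otimes>\<^sub>M lborel))"

definition lam :: "real \<Rightarrow> real \<Rightarrow> ennreal \<Rightarrow> 'a::euclidean_space set \<Rightarrow> ennreal" where
  "lam s p q \<Omega> = (INF u\<in>{u \<in> test_functions \<Omega>. Lq_norm q \<Omega> u = 1}. gagliardo s p UNIV UNIV u)"

definition sobolev_exp :: "nat \<Rightarrow> real \<Rightarrow> real \<Rightarrow> real" where
  "sobolev_exp N p s = real N * p / (real N - s * p)"

definition admissible :: "nat \<Rightarrow> real \<Rightarrow> real \<Rightarrow> ennreal \<Rightarrow> bool" where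
  "admissible N p s q \<longleftrightarrow> ennreal p \<le> q \<and>
     (s * p < real N \<longrightarrow> q \<le> ennreal (sobolev_exp N p s)) \<and>
     (s * p = real N \<longrightarrow> q < \<infinity>) \<and>
     (s * p > real N \<longrightarrow> q \<le> \<infinity>)"

text \<open>The quotient \<open>p / q\<close>, equal to \<open>0\<close> for \<open>q = \<infinity>\<close>.\<close>

definition exp_ratio :: "real \<Rightarrow> ennreal \<Rightarrow> real" where
  "exp_ratio p q = (if q = \<infinity> then 0 else p / enn2real q)"

end

theory Submission
  imports Defs "HOL-Probability.Probability_Measure"
begin

text \<open>
  Write \<open>\<gamma> = N + s p\<close>. The idea is to insert \<open>\<phi> = (u - av u) \<eta>\<close> into the definition of
  \<open>\<lambda>\<close>, where \<open>\<eta>\<close> is a smooth cutoff that is bounded below on the small ball and is supported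
  in the large one. By homogeneity \<open>\<lambda> \<parallel>\<phi>\<parallel>\<^sup>p \<le> [\<phi>]\<^sup>p\<close> (\<open>lam_mult_Lq_norm_le\<close>), and
  \<open>\<parallel>\<phi>\<parallel>\<close> dominates a fixed multiple of the norm of \<open>u - av u\<close> on the small ball. Everything is done for
  the pair of balls of radii \<open>\<rho> < 1\<close> and \<open>1\<close> and transported by dilation.

  The product rule splits \<open>[\<phi>]\<^sup>p\<close> into the seminorm of \<open>u\<close> over \<open>B \<times> \<real>\<^sup>N\<close> and the integral of
  \<open>\<bar>u - av u\<bar>\<^sup>p\<close> over \<open>B\<close> against \<open>\<integral> \<bar>\<eta> x - \<eta> y\<bar>\<^sup>p / \<bar>x - y\<bar>\<^sup>\<gamma> dy\<close>. For a Lipschitz constant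
  \<open>L\<close> of order \<open>1 / (1 - \<rho>)\<close> the latter is at most a multiple of \<open>L powr (s p) / (s (1 - s))\<close>
  (\<open>nn_integral_kernel_lipschitz_le\<close>), which is the source of the blow-up rate of \<open>W\<close>.
  The factor \<open>1 / (s (1 - s))\<close> has to be compensated, so one needs a Poincare inequality
  \<open>\<integral>\<integral>\<^bsub>B \<times> B\<^esub> \<bar>u x - u y\<bar>\<^sup>p \<le> C s (1 - s) [u]\<^sup>p\<close> whose constant \<open>C\<close> depends only on
  \<open>N\<close> and \<open>p\<close> (\<open>oscillation_le\<close>). It combines two estimates. Near \<open>s = 0\<close> the gain comes from far
  away: for \<open>x\<close>, \<open>x'\<close> in \<open>B\<close> one compares both values with \<open>u y\<close> for \<open>\<bar>y\<bar> \<ge> 1\<close>, and the mass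
  \<open>\<integral> \<bar>y\<bar> powr (- \<gamma>) dy\<close> over that region is of order \<open>1 / s\<close> (\<open>oscillation_le_far\<close>). Near \<open>s = 1\<close> it
  comes from short distances: going through midpoints bounds differences at distance \<open>2 t\<close> by differences
  at distance \<open>t\<close> with a factor that makes each dyadic shell contribute almost equally to
  the seminorm (\<open>oscillation_le_near\<close>).

  The resulting constant is uniform in \<open>s\<close> and \<open>q\<close>, so that one can choose
  \<open>W = C (1 - sqrt N / t) powr (- s p)\<close> with \<open>C\<close> depending on \<open>N\<close> and \<open>p\<close> only, for which
  the four limits are evident. For large \<open>t = R / r\<close> the average over the small ball would spoil the
  constant; there the radius \<open>R\<close> is first lowered to \<open>2 sqrt N r\<close>, which is harmless since
  the power of \<open>R\<close> in the claim is nonnegative for admissible \<open>q\<close>.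
\<close>

section \<open>Smooth functions and a radial cutoff\<close>

text \<open>
  The recursion for \<open>Ck\<close> speaks of the chosen term \<open>frechet_derivative\<close>; this form lets a closure
  property be proved from any explicit formula for the derivative.
\<close>

lemma Ck_SucI:
  assumes "\<And>x. (f has_derivative D x) (at x)" and "\<And>v. Ck k (\<lambda>x. D x v)"
  shows "Ck (Suc k) f"
proof -
  have "frechet_derivative f (at x) = D x" for x
    using frechet_derivative_at[OF assms(1)[of x]] by simp
  then show ?thesis
    using assms by (auto simp: differentiable_def)
qed

lemma Ck_SucD:
  assumes "Ck (Suc k) f"
  shows "(f has_derivative frechet_derivative f (at x)) (at x)"
    and "Ck k (\<lambda>x. frechet_derivative f (at x) v)"
  using assms by (auto simp: frechet_derivative_works)

lemma Ck_SucD_Ck: "Ck (Suc k) f \<Longrightarrow> Ck k f"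
proof (induction k arbitrary: f)
  case 0
  then show ?case
    by (simp add: continuous_at_imp_continuous_on differentiable_imp_continuous_within)
next
  case (Suc k)
  have "Ck k (\<lambda>x. frechet_derivative f (at x) v)" for v
    by (rule Suc.IH) (rule Ck_SucD(2)[OF Suc.prems])
  with Ck_SucD(1)[OF Suc.prems] show ?case
    by (intro Ck_SucI)
qed

lemma Ck_const: "Ck k (\<lambda>x. c)"
proof (induction k arbitrary: c)
  case (Suc k)
  show ?case
    by (rule Ck_SucI[OF has_derivative_const Suc.IH])
qed simp

lemma Ck_add: "Ck k f \<Longrightarrow> Ck k g \<Longrightarrow> Ck k (\<lambda>x. f x + g x)"
proof (induction k arbitrary: f g)
  case 0
  then show ?case
    by (simp add: continuous_on_add)
next
  case (Suc k)
  show ?case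
    by (rule Ck_SucI[OF has_derivative_add[OF Ck_SucD(1)[OF Suc.prems(1)] Ck_SucD(1)[OF Suc.prems(2)]]])
      (intro Suc.IH Ck_SucD(2)[OF Suc.prems(1)] Ck_SucD(2)[OF Suc.prems(2)])
qed

lemma Ck_mult: "Ck k f \<Longrightarrow> Ck k g \<Longrightarrow> Ck k (\<lambda>x. f x * g x)"
proof (induction k arbitrary: f g)
  case 0
  then show ?case
    by (simp add: continuous_on_mult)
next
  case (Suc k)
  show ?case
    by (rule Ck_SucI[OF has_derivative_mult[OF Ck_SucD(1)[OF Suc.prems(1)] Ck_SucD(1)[OF Suc.prems(2)]]])
      (intro Ck_add Suc.IH Ck_SucD(2)[OF Suc.prems(1)] Ck_SucD(2)[OF Suc.prems(2)]
        Ck_SucD_Ck[OF Suc.prems(1)] Ck_SucD_Ck[OF Suc.prems(2)])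
qed

lemma Ck_affine:
  fixes f :: "'a::euclidean_space \<Rightarrow> real"
  shows "Ck k f \<Longrightarrow> Ck k (\<lambda>x. f (a + c *\<^sub>R x))"
proof (induction k arbitrary: f)
  case 0
  then have "continuous_on UNIV (f \<circ> (\<lambda>x. a + c *\<^sub>R x))"
    by (intro continuous_on_compose continuous_intros) (auto intro: continuous_on_subset)
  then show ?case
    by (simp add: o_def)
next
  case (Suc k)
  have der: "((\<lambda>x. f (a + c *\<^sub>R x)) has_derivative
      (\<lambda>v. c * frechet_derivative f (at (a + c *\<^sub>R x)) v)) (at x)" for x
  proof -
    have "((\<lambda>x. f (a + c *\<^sub>R x)) has_derivative
        (\<lambda>v. frechet_derivative f (at (a + c *\<^sub>R x)) (c *\<^sub>R v))) (at x)"
      by (rule has_derivative_compose[OF _ Ck_SucD(1)[OF Suc.prems]])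
        (auto intro!: derivative_eq_intros)
    moreover have "linear (frechet_derivative f (at (a + c *\<^sub>R x)))"
      using Ck_SucD(1)[OF Suc.prems] has_derivative_linear by blast
    ultimately show ?thesis
      by (simp add: linear_scale)
  qed
  show ?case
    by (rule Ck_SucI[OF der]) (intro Ck_mult Ck_const Suc.IH[OF Ck_SucD(2)[OF Suc.prems]])
qed

lemma Ck_inner: "Ck k (\<lambda>x. x \<bullet> v)"
proof (cases k)
  case 0
  then show ?thesis
    by (auto intro!: continuous_intros)
next
  case (Suc m)
  have "((\<lambda>x. x \<bullet> v) has_derivative (\<lambda>w. w \<bullet> v)) (at x)" for x
    by (auto intro!: derivative_eq_intros)
  then show ?thesis
    unfolding Suc by (rule Ck_SucI) (rule Ck_const)
qed

text \<open>
  The norm itself is not differentiable at the origin, which is why the cutoff below is built from its square.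
\<close>

lemma Ck_norm_square: "Ck k (\<lambda>x::'a::euclidean_space. (norm x)\<^sup>2)"
proof (cases k)
  case 0
  then show ?thesis
    by (auto intro!: continuous_intros)
next
  case (Suc m)
  have "((\<lambda>x::'a. (norm x)\<^sup>2) has_derivative (\<lambda>v. 2 * (x \<bullet> v))) (at x)" for x
    unfolding power2_norm_eq_inner by (auto intro!: derivative_eq_intros simp: inner_commute)
  then show ?thesis
    unfolding Suc by (rule Ck_SucI) (intro Ck_mult Ck_const Ck_inner)
qed

text \<open>
  Derivatives of \<open>exp (- 1 / t)\<close> are polynomials in \<open>1 / t\<close> times the function itself. Allowing an arbitrary
  polynomial factor gives a family that is closed under differentiation, so that smoothness is a plain induction.
\<close>

definition flat :: "real poly \<Rightarrow> real \<Rightarrow> real" where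
  "flat P t = (if 0 < t then poly P (1 / t) * exp (- (1 / t)) else 0)"

lemma flat_little_o: "((\<lambda>t. flat P t / t) \<longlongrightarrow> 0) (at 0)"
proof -
  have "((\<lambda>z. poly (pCons 0 P) z / exp z) \<longlongrightarrow> 0) at_top"
  proof -
    have "((\<lambda>z. \<Sum>i\<le>degree (pCons 0 P). coeff (pCons 0 P) i * (z ^ i / exp z)) \<longlongrightarrow>
        (\<Sum>i\<le>degree (pCons 0 P). coeff (pCons 0 P) i * 0)) at_top"
      by (intro tendsto_sum tendsto_mult tendsto_const tendsto_power_div_exp_0)
    then show ?thesis
      by (simp add: poly_altdef sum_divide_distrib)
  qed
  then have "((\<lambda>t. poly (pCons 0 P) (inverse t) / exp (inverse t)) \<longlongrightarrow> 0) (at_right (0::real))"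
    by (rule filterlim_compose[OF _ filterlim_inverse_at_top_right])
  then have "((\<lambda>t. flat P t / t) \<longlongrightarrow> 0) (at_right 0)"
    by (rule Lim_transform_eventually)
      (auto simp: eventually_at_filter flat_def exp_minus field_simps)
  moreover have "((\<lambda>t. flat P t / t) \<longlongrightarrow> 0) (at_left 0)"
    by (rule Lim_transform_eventually[OF tendsto_const])
      (auto simp: eventually_at_filter flat_def)
  ultimately show ?thesis
    by (simp add: filterlim_at_split)
qed

text \<open>
  With \<open>z = 1 / t\<close> one has \<open>dz / dt = - z\<^sup>2\<close>, and \<open>P z exp (- z)\<close> has \<open>z\<close>-derivative
  \<open>(P' - P) z exp (- z)\<close>. At the origin the derivative vanishes because the exponential beats every power.
\<close>

lemma DERIV_flat: "(flat P has_real_derivative flat ([:0, 0, 1:] * (P - pderiv P)) t) (at t)"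
proof -
  consider "t > 0" | "t < 0" | "t = 0"
    by linarith
  then show ?thesis
  proof cases
    case 1
    have "((\<lambda>t. poly P (1 / t) * exp (- (1 / t))) has_real_derivative
        flat ([:0, 0, 1:] * (P - pderiv P)) t) (at t)"
      using 1 by (auto intro!: derivative_eq_intros DERIV_chain2[OF poly_DERIV]
          simp: flat_def field_simps power2_eq_square)
    then show ?thesis
      by (rule has_field_derivative_transform_within_open[where S = "{0<..}"])
        (use 1 in \<open>auto simp: flat_def\<close>)
  next
    case 2
    have "((\<lambda>t. 0) has_real_derivative flat ([:0, 0, 1:] * (P - pderiv P)) t) (at t)"
      using 2 by (simp add: flat_def)
    then show ?thesis
      by (rule has_field_derivative_transform_within_open[where S = "{..<0}"])
        (use 2 in \<open>auto simp: flat_def\<close>)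
  next
    case 3
    then show ?thesis
      using flat_little_o[of P] by (simp add: has_field_derivative_iff flat_def)
  qed
qed

lemma Ck_flat_compose:
  assumes "\<And>k. Ck k f"
  shows "Ck k (\<lambda>x. flat P (f x))"
proof (induction k arbitrary: P)
  case 0
  have "continuous_on UNIV (flat P)"
    by (intro continuous_at_imp_continuous_on ballI DERIV_isCont[OF DERIV_flat])
  with assms[of 0] have "continuous_on UNIV (flat P \<circ> f)"
    by (intro continuous_on_compose) (auto intro: continuous_on_subset)
  then show ?case
    by (simp add: o_def)
next
  case (Suc k)
  note f = Ck_SucD[OF assms]
  have "((\<lambda>x. flat P (f x)) has_derivative
      (\<lambda>v. frechet_derivative f (at x) v * flat ([:0, 0, 1:] * (P - pderiv P)) (f x))) (at x)" for x
    using has_derivative_compose[OF f(1) DERIV_flat[unfolded has_field_derivative_def]]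
    by (simp add: mult_ac)
  then show ?case
    by (rule Ck_SucI) (intro Ck_mult f(2) Suc.IH)
qed

text \<open>
  The argument of \<open>exp (- 1 / _)\<close> equals \<open>1\<close> on the sphere of radius \<open>a\<close> and \<open>0\<close> on that of radius \<open>b\<close>.
  The function is thus at least \<open>1 / e\<close> on the inner ball, which serves as well as a plateau of height \<open>1\<close>.
\<close>

definition bump :: "real \<Rightarrow> real \<Rightarrow> 'a::euclidean_space \<Rightarrow> real" where
  "bump a b x = flat 1 ((b\<^sup>2 - (norm x)\<^sup>2) / (b\<^sup>2 - a\<^sup>2))"

lemma flat_1_lipschitz: "\<bar>flat 1 t - flat 1 t'\<bar> \<le> 4 * \<bar>t - t'\<bar>"
proof -
  have bound: "\<bar>flat ([:0, 0, 1:] * (1 - pderiv 1)) x\<bar> \<le> 4" for x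
  proof (cases "x > 0")
    case True
    define z where "z = 1 / x"
    have "z > 0"
      using True by (simp add: z_def)
    have "z / 2 \<le> exp (z / 2)"
      using exp_ge_add_one_self[of "z / 2"] by linarith
    then have "(z / 2)\<^sup>2 \<le> (exp (z / 2))\<^sup>2"
      using \<open>z > 0\<close> by (intro power_mono) auto
    also have "\<dots> = exp z"
      by (simp add: power2_eq_square flip: exp_add)
    finally have "z\<^sup>2 \<le> 4 * exp z"
      by (simp add: power2_eq_square)
    then show ?thesis
      using True by (simp add: flat_def z_def exp_minus power2_eq_square field_simps)
  qed (simp add: flat_def)
  have "norm (flat 1 t - flat 1 t') \<le> 4 * norm (t - t')"
    by (rule field_differentiable_bound[of UNIV _ "flat ([:0, 0, 1:] * (1 - pderiv 1))"])
      (use bound DERIV_flat[of 1] in auto)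
  then show ?thesis
    by simp
qed

lemma flat_1_bounds: "0 \<le> flat 1 t" "flat 1 t \<le> 1" "1 \<le> t \<Longrightarrow> exp (-1) \<le> flat 1 t"
  by (auto simp: flat_def)

lemma bump_bounds:
  assumes "0 < a" "a < b"
  shows "0 \<le> bump a b x" "bump a b x \<le> 1"
    and "norm x < a \<Longrightarrow> exp (-1) \<le> bump a b x"
    and "b \<le> norm x \<Longrightarrow> bump a b x = 0"
proof -
  have ab: "a\<^sup>2 < b\<^sup>2"
    using assms by (simp add: power_strict_mono)
  show "exp (-1) \<le> bump a b x" if "norm x < a"
  proof -
    have "(norm x)\<^sup>2 \<le> a\<^sup>2"
      using that by (intro power_mono) auto
    then show ?thesis
      unfolding bump_def using ab by (intro flat_1_bounds) (simp add: field_simps)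
  qed
  show "bump a b x = 0" if "b \<le> norm x"
  proof -
    have "b\<^sup>2 \<le> (norm x)\<^sup>2"
      using that assms by (intro power_mono) auto
    then show ?thesis
      using ab by (simp add: bump_def flat_def zero_less_divide_iff)
  qed
qed (auto simp: bump_def flat_1_bounds)

text \<open>
  The sharp dependence on \<open>b - a\<close> is what produces the exact blow-up rate of the weight. The squared norm is not globally
  Lipschitz, but the function sees only the truncated norm \<open>min \<bar>x\<bar> b\<close>, whose square has Lipschitz constant \<open>2 b\<close>.
\<close>

lemma bump_lipschitz:
  assumes "0 < a" "a < b"
  shows "\<bar>bump a b x - bump a b y\<bar> \<le> 8 / (b - a) * norm (x - y)"
proof -
  define m where "m z = min (norm z) b" for z :: 'a
  have ab: "0 < b\<^sup>2 - a\<^sup>2"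
    using assms by (simp add: power_strict_mono)
  have eq: "bump a b z = flat 1 ((b\<^sup>2 - (m z)\<^sup>2) / (b\<^sup>2 - a\<^sup>2))" for z
    using bump_bounds(4)[OF assms, of z] by (auto simp: m_def min_def bump_def flat_def)
  have m: "0 \<le> m z" "m z \<le> b" for z
    using assms by (auto simp: m_def)
  have "\<bar>bump a b x - bump a b y\<bar>
      \<le> 4 * \<bar>(b\<^sup>2 - (m x)\<^sup>2) / (b\<^sup>2 - a\<^sup>2) - (b\<^sup>2 - (m y)\<^sup>2) / (b\<^sup>2 - a\<^sup>2)\<bar>"
    unfolding eq by (rule flat_1_lipschitz)
  also have "\<dots> = 4 * ((m x + m y) * \<bar>m x - m y\<bar>) / (b\<^sup>2 - a\<^sup>2)"
  proof -
    have "(b\<^sup>2 - (m x)\<^sup>2) / (b\<^sup>2 - a\<^sup>2) - (b\<^sup>2 - (m y)\<^sup>2) / (b\<^sup>2 - a\<^sup>2)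
        = (m x + m y) * (m y - m x) / (b\<^sup>2 - a\<^sup>2)"
      by (simp add: power2_eq_square algebra_simps flip: diff_divide_distrib)
    then show ?thesis
      using ab m[of x] m[of y] by (simp add: abs_mult abs_minus_commute)
  qed
  also have "\<dots> \<le> 4 * ((b + b) * norm (x - y)) / (b\<^sup>2 - a\<^sup>2)"
  proof -
    have "\<bar>m x - m y\<bar> \<le> norm (x - y)"
      using norm_triangle_ineq3[of x y] by (auto simp: m_def min_def)
    then show ?thesis
      using ab m[of x] m[of y] by (intro divide_right_mono mult_left_mono mult_mono) auto
  qed
  also have "\<dots> = 8 * b / ((b - a) * (b + a)) * norm (x - y)"
    by (simp add: power2_eq_square algebra_simps)
  also have "\<dots> \<le> 8 / (b - a) * norm (x - y)"
  proof -
    have "8 * b / ((b - a) * (b + a)) \<le> 8 * (b + a) / ((b - a) * (b + a))"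
      using assms by (intro divide_right_mono) auto
    also have "\<dots> = 8 / (b - a)"
      by (rule nonzero_mult_divide_mult_cancel_right) (use assms in auto)
    finally show ?thesis
      by (rule mult_right_mono) simp
  qed
  finally show ?thesis .
qed

lemma Ck_bump: "Ck k (bump a b)"
proof -
  have "Ck k (\<lambda>x::'a. b\<^sup>2 / (b\<^sup>2 - a\<^sup>2) + (- 1 / (b\<^sup>2 - a\<^sup>2)) * (norm x)\<^sup>2)" for k
    by (intro Ck_add Ck_mult Ck_const Ck_norm_square)
  then have "Ck k (\<lambda>x::'a. (b\<^sup>2 - (norm x)\<^sup>2) / (b\<^sup>2 - a\<^sup>2))" for k
    by (simp add: diff_divide_distrib)
  then show ?thesis
    unfolding bump_def[abs_def] by (rule Ck_flat_compose)
qed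

lemma mult_bump_test_function:
  assumes "\<And>k. Ck k f" and "0 < a" "a < b" "b < 1"
  shows "(\<lambda>x. f x * bump a b x) \<in> test_functions (ball 0 1)"
proof -
  have sub: "closure {x. f x * bump a b x \<noteq> 0} \<subseteq> cball 0 b"
    by (rule closure_minimal) (use bump_bounds(4)[OF assms(2,3)] in \<open>force simp: not_le\<close>)+
  then have "compact (closure {x. f x * bump a b x \<noteq> 0})"
    by (meson bounded_cball bounded_subset closed_closure compact_eq_bounded_closed)
  moreover have "closure {x. f x * bump a b x \<noteq> 0} \<subseteq> ball 0 1"
    using sub assms(4) by (auto simp: subset_iff)
  ultimately show ?thesis
    unfolding test_functions_def using assms(1) by (auto intro!: Ck_mult Ck_bump)
qed

section \<open>Dilations and power integrals\<close>

lemma nn_integral_lborel_affine: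
  fixes f :: "'a::euclidean_space \<Rightarrow> ennreal"
  assumes [measurable]: "f \<in> borel_measurable borel" and "0 < c"
  shows "(\<integral>\<^sup>+x. f x \<partial>lborel) = ennreal (c ^ DIM('a)) * (\<integral>\<^sup>+x. f (t + c *\<^sub>R x) \<partial>lborel)"
proof -
  have "(\<integral>\<^sup>+x. f x \<partial>lborel)
      = (\<integral>\<^sup>+x. f x \<partial>density (distr lborel borel (\<lambda>x. t + c *\<^sub>R x)) (\<lambda>_. ennreal (\<bar>c\<bar> ^ DIM('a))))"
    using lborel_affine[of c t] assms(2) by simp
  also have "\<dots> = ennreal (c ^ DIM('a)) * (\<integral>\<^sup>+x. f (t + c *\<^sub>R x) \<partial>lborel)"
    using assms(2) by (simp add: nn_integral_density nn_integral_distr nn_integral_cmult)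
  finally show ?thesis .
qed

text \<open>
  Convexity of \<open>s \<mapsto> 2 powr (- s p)\<close> on \<open>[0, 1]\<close> places it below its chord; this turns the sums of geometric series with
  ratio \<open>2 powr (- s p)\<close> into multiples of \<open>1 / s\<close>.
\<close>

lemma two_powr_minus_le:
  fixes p s :: real
  assumes "1 \<le> p" "0 \<le> s" "s \<le> 1"
  shows "s / 2 \<le> 1 - 2 powr - (s * p)"
proof -
  have "exp ((1 - s) *\<^sub>R 0 + s *\<^sub>R (- p * ln 2)) \<le> (1 - s) * exp 0 + s * exp (- p * ln (2::real))"
    by (rule convex_onD[OF exp_convex, of s]) (use assms in auto)
  then have "2 powr - (s * p) \<le> 1 - s + s * 2 powr - p"
    by (simp add: powr_def mult_ac)
  moreover have "2 powr - p \<le> 2 powr - (1::real)"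
    using assms by (intro powr_mono) auto
  then have "s * 2 powr - p \<le> s * (1 / 2)"
    using assms by (intro mult_left_mono) (auto simp: powr_minus)
  ultimately show ?thesis
    by simp
qed

lemma one_minus_two_powr_le:
  fixes x :: real
  assumes "0 \<le> x"
  shows "1 - 2 powr - x \<le> x"
proof -
  have "1 - x * ln 2 \<le> 2 powr - x"
    using exp_ge_add_one_self[of "- (x * ln 2)"] by (simp add: powr_def)
  moreover have "x * ln 2 \<le> x * 1"
    using assms ln_le_minus_one[of 2] by (intro mult_left_mono) auto
  ultimately show ?thesis
    by simp
qed

definition annulus :: "real \<Rightarrow> real \<Rightarrow> 'a::euclidean_space set" where
  "annulus a b = {h. a \<le> norm h \<and> norm h < b}"

lemma annulus_sets [measurable]: "annulus a b \<in> sets borel"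
  unfolding annulus_def by measurable

lemma radial_power_dilation:
  assumes "0 < c"
  shows "(\<integral>\<^sup>+h\<in>annulus (c * a) (c * b). ennreal (norm (h::'a::euclidean_space) powr \<beta>) \<partial>lborel)
    = ennreal (c powr (real DIM('a) + \<beta>)) * (\<integral>\<^sup>+h\<in>annulus a b. ennreal (norm (h::'a) powr \<beta>) \<partial>lborel)"
proof -
  have "(\<integral>\<^sup>+h\<in>annulus (c * a) (c * b). ennreal (norm (h::'a) powr \<beta>) \<partial>lborel)
      = ennreal (c ^ DIM('a)) * (\<integral>\<^sup>+h. ennreal (norm (0 + c *\<^sub>R (h::'a)) powr \<beta>)
          * indicator (annulus (c * a) (c * b)) (0 + c *\<^sub>R h) \<partial>lborel)"
    by (rule nn_integral_lborel_affine) (use assms in measurable)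
  also have "(\<integral>\<^sup>+h. ennreal (norm (0 + c *\<^sub>R (h::'a)) powr \<beta>)
          * indicator (annulus (c * a) (c * b)) (0 + c *\<^sub>R h) \<partial>lborel)
      = (\<integral>\<^sup>+h. ennreal (c powr \<beta>) * (ennreal (norm (h::'a) powr \<beta>) * indicator (annulus a b) h) \<partial>lborel)"
    using assms by (intro nn_integral_cong)
      (auto simp: annulus_def indicator_def powr_mult ennreal_mult' mult_ac)
  also have "\<dots> = ennreal (c powr \<beta>) * (\<integral>\<^sup>+h\<in>annulus a b. ennreal (norm (h::'a) powr \<beta>) \<partial>lborel)"
    by (rule nn_integral_cmult) measurable
  finally show ?thesis
    using assms by (simp add: powr_add powr_realpow ennreal_mult' mult_ac)
qed

text \<open>
  Power integrals are evaluated by dyadic self-similarity: one step of the exhaustion adds a fixed shell and a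
  dilated copy of the previous set. The bound \<open>S / (1 - \<theta>)\<close> is the fixed point of \<open>x \<mapsto> S + \<theta> x\<close>; proving it along the
  exhaustion yields finiteness of the limit at the same time.
\<close>

lemma geometric_exhaustion:
  fixes f :: "'a \<Rightarrow> ennreal"
  assumes [measurable]: "f \<in> borel_measurable M" "\<And>n. A n \<in> sets M"
    and "incseq A" and "0 \<le> S" "0 \<le> \<theta>" "\<theta> < 1"
    and "(\<integral>\<^sup>+x\<in>A 0. f x \<partial>M) = 0"
    and "\<And>n. (\<integral>\<^sup>+x\<in>A (Suc n). f x \<partial>M) \<le> ennreal S + ennreal \<theta> * (\<integral>\<^sup>+x\<in>A n. f x \<partial>M)"
  shows "(\<integral>\<^sup>+x\<in>(\<Union>n. A n). f x \<partial>M) \<le> ennreal (S / (1 - \<theta>))"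
proof -
  have bound: "(\<integral>\<^sup>+x\<in>A n. f x \<partial>M) \<le> ennreal (S / (1 - \<theta>))" for n
  proof (induction n)
    case (Suc n)
    have "(\<integral>\<^sup>+x\<in>A (Suc n). f x \<partial>M) \<le> ennreal S + ennreal \<theta> * ennreal (S / (1 - \<theta>))"
      by (rule order_trans[OF assms(8)]) (intro add_left_mono mult_left_mono Suc, simp)
    also have "\<dots> = ennreal (S + \<theta> * (S / (1 - \<theta>)))"
      using assms by (subst ennreal_mult'[symmetric]) (auto simp flip: ennreal_plus)
    also have "S + \<theta> * (S / (1 - \<theta>)) = S / (1 - \<theta>)"
      using assms(6) by (simp add: field_simps)
    finally show ?case .
  qed (simp add: assms)
  have "(\<integral>\<^sup>+x\<in>(\<Union>n. A n). f x \<partial>M) = emeasure (density M f) (\<Union>n. A n)"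
    by (simp add: emeasure_density)
  also have "\<dots> = (SUP n. emeasure (density M f) (A n))"
    by (rule SUP_emeasure_incseq[symmetric]) (use assms(3) in auto)
  also have "\<dots> \<le> ennreal (S / (1 - \<theta>))"
    using bound by (intro SUP_least) (simp add: emeasure_density)
  finally show ?thesis .
qed

lemma nn_integral_annulus_le:
  assumes "\<And>h::'a::euclidean_space. h \<in> annulus a b \<Longrightarrow> norm h powr \<beta> \<le> K" and "0 \<le> K" "0 \<le> b"
  shows "(\<integral>\<^sup>+h\<in>annulus a b. ennreal (norm (h::'a) powr \<beta>) \<partial>lborel)
    \<le> ennreal (K * (unit_ball_vol (real DIM('a)) * b ^ DIM('a)))"
proof -
  have "(\<integral>\<^sup>+h\<in>annulus a b. ennreal (norm (h::'a) powr \<beta>) \<partial>lborel)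
      \<le> (\<integral>\<^sup>+h. ennreal K * indicator (ball 0 b) (h::'a) \<partial>lborel)"
    using assms(1) by (intro nn_integral_mono)
      (auto simp: indicator_def annulus_def intro!: ennreal_leI)
  also have "\<dots> = ennreal K * emeasure lborel (ball (0::'a) b)"
    by (rule nn_integral_cmult_indicator) simp
  finally show ?thesis
    using assms by (simp add: emeasure_ball ennreal_mult')
qed

lemma nn_integral_far_le:
  assumes "0 < \<sigma>"
  shows "(\<integral>\<^sup>+h\<in>{h. 1 \<le> norm h}. ennreal (norm (h::'a::euclidean_space) powr - (real DIM('a) + \<sigma>)) \<partial>lborel)
    \<le> ennreal (unit_ball_vol (real DIM('a)) * 2 ^ DIM('a) / (1 - 2 powr - \<sigma>))"
proof -
  define \<beta> where "\<beta> = - (real DIM('a) + \<sigma>)"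
  define A :: "nat \<Rightarrow> 'a set" where "A n = annulus 1 (2 ^ n)" for n
  have UN: "(\<Union>n. A n) = {h. 1 \<le> norm h}"
    using real_arch_pow[of 2] by (auto simp: A_def annulus_def)
  have "(\<integral>\<^sup>+h\<in>(\<Union>n. A n). ennreal (norm h powr \<beta>) \<partial>lborel)
      \<le> ennreal (unit_ball_vol (real DIM('a)) * 2 ^ DIM('a) / (1 - 2 powr - \<sigma>))"
  proof (rule geometric_exhaustion)
    show "incseq A"
    proof (rule incseq_SucI, rule subsetI)
      fix n and h :: 'a assume "h \<in> A n"
      then have "norm h < 2 ^ n" "1 \<le> norm h" by (auto simp: A_def annulus_def)
      then show "h \<in> A (Suc n)" by (auto simp: A_def annulus_def)
    qed
    show "(\<integral>\<^sup>+h\<in>A 0. ennreal (norm h powr \<beta>) \<partial>lborel) = 0"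
      by (simp add: A_def annulus_def not_less[symmetric] flip: not_less)
    fix n
    have sub: "A (Suc n) \<subseteq> annulus 1 2 \<union> annulus (2 * 1) (2 * 2 ^ n)"
      by (auto simp: A_def annulus_def)
    have "(\<integral>\<^sup>+h\<in>A (Suc n). ennreal (norm h powr \<beta>) \<partial>lborel)
        \<le> (\<integral>\<^sup>+h. ennreal (norm (h::'a) powr \<beta>) * indicator (annulus 1 2) h
          + ennreal (norm h powr \<beta>) * indicator (annulus (2 * 1) (2 * 2 ^ n)) h \<partial>lborel)"
      using sub by (intro nn_integral_mono) (auto simp: indicator_def)
    also have "\<dots> = (\<integral>\<^sup>+h\<in>annulus 1 2. ennreal (norm (h::'a) powr \<beta>) \<partial>lborel)
        + (\<integral>\<^sup>+h\<in>annulus (2 * 1) (2 * 2 ^ n). ennreal (norm (h::'a) powr \<beta>) \<partial>lborel)"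
      by (rule nn_integral_add) measurable
    also have "\<dots> \<le> ennreal (1 * (unit_ball_vol (real DIM('a)) * 2 ^ DIM('a)))
        + ennreal (2 powr - \<sigma>) * (\<integral>\<^sup>+h\<in>A n. ennreal (norm h powr \<beta>) \<partial>lborel)"
    proof (intro add_mono nn_integral_annulus_le)
      show "norm h powr \<beta> \<le> 1" if "h \<in> annulus 1 2" for h :: 'a
        using powr_mono[of \<beta> 0 "norm h"] that assms by (auto simp: annulus_def \<beta>_def split: if_splits)
      show "(\<integral>\<^sup>+h\<in>annulus (2 * 1) (2 * 2 ^ n). ennreal (norm (h::'a) powr \<beta>) \<partial>lborel)
          \<le> ennreal (2 powr - \<sigma>) * (\<integral>\<^sup>+h\<in>A n. ennreal (norm h powr \<beta>) \<partial>lborel)"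
        by (subst radial_power_dilation) (auto simp: A_def \<beta>_def)
    qed auto
    finally show "(\<integral>\<^sup>+h\<in>A (Suc n). ennreal (norm h powr \<beta>) \<partial>lborel)
        \<le> ennreal (unit_ball_vol (real DIM('a)) * 2 ^ DIM('a))
        + ennreal (2 powr - \<sigma>) * (\<integral>\<^sup>+h\<in>A n. ennreal (norm h powr \<beta>) \<partial>lborel)"
      by simp
  qed (use assms powr_less_mono[of "- \<sigma>" 0 2] in \<open>auto simp: A_def\<close>)
  then show ?thesis
    unfolding UN \<beta>_def .
qed

lemma nn_integral_near_le:
  assumes "0 < \<tau>"
  shows "(\<integral>\<^sup>+h\<in>{h. norm h < 1}. ennreal (norm (h::'a::euclidean_space) powr (\<tau> - real DIM('a))) \<partial>lborel)
    \<le> ennreal (unit_ball_vol (real DIM('a)) * 2 ^ DIM('a) / (1 - 2 powr - \<tau>))"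
proof -
  define \<beta> where "\<beta> = \<tau> - real DIM('a)"
  define A :: "nat \<Rightarrow> 'a set" where "A n = annulus ((1 / 2) ^ n) 1" for n
  \<comment> \<open>The missing origin is immaterial: the integrand takes the value \<open>0 powr \<beta> = 0\<close> there.\<close>
  have UN: "(\<Union>n. A n) = {h. norm h < 1} - {0}"
  proof (intro equalityI subsetI)
    fix h :: 'a assume h: "h \<in> {h. norm h < 1} - {0}"
    then obtain n where "(1 / 2) ^ n < norm h"
      using real_arch_pow_inv[of "norm h" "1 / 2"] by auto
    with h show "h \<in> (\<Union>n. A n)"
      by (auto simp: A_def annulus_def intro!: exI[of _ n])
  next
    fix h :: 'a assume "h \<in> (\<Union>n. A n)"
    then obtain n where "(1 / 2) ^ n \<le> norm h" "norm h < 1" by (auto simp: A_def annulus_def)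
    moreover have "0 < (1 / 2 :: real) ^ n" by simp
    ultimately have "0 < norm h" by linarith
    with \<open>norm h < 1\<close> show "h \<in> {h. norm h < 1} - {0}" by simp
  qed
  have "(\<integral>\<^sup>+h\<in>(\<Union>n. A n). ennreal (norm h powr \<beta>) \<partial>lborel)
      \<le> ennreal (unit_ball_vol (real DIM('a)) * 2 ^ DIM('a) / (1 - 2 powr - \<tau>))"
  proof (rule geometric_exhaustion)
    show "incseq A"
    proof (rule incseq_SucI, rule subsetI)
      fix n and h :: 'a assume "h \<in> A n"
      then have "(1 / 2) ^ n \<le> norm h" "norm h < 1" by (auto simp: A_def annulus_def)
      moreover have "(1 / 2 :: real) ^ Suc n \<le> (1 / 2) ^ n" by simp
      ultimately have "(1 / 2) ^ Suc n \<le> norm h" by linarith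
      with \<open>norm h < 1\<close> show "h \<in> A (Suc n)" unfolding A_def annulus_def by auto
    qed
    show "(\<integral>\<^sup>+h\<in>A 0. ennreal (norm h powr \<beta>) \<partial>lborel) = 0"
      by (simp add: A_def annulus_def not_less[symmetric] flip: not_less)
    fix n
    have sub: "A (Suc n) \<subseteq> annulus (1 / 2) 1 \<union> annulus (1 / 2 * (1 / 2) ^ n) (1 / 2 * 1)"
      by (auto simp: A_def annulus_def field_simps)
    have "(\<integral>\<^sup>+h\<in>A (Suc n). ennreal (norm h powr \<beta>) \<partial>lborel)
        \<le> (\<integral>\<^sup>+h. ennreal (norm (h::'a) powr \<beta>) * indicator (annulus (1 / 2) 1) h
          + ennreal (norm h powr \<beta>) * indicator (annulus (1 / 2 * (1 / 2) ^ n) (1 / 2 * 1)) h \<partial>lborel)"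
      using sub by (intro nn_integral_mono) (auto simp: indicator_def)
    also have "\<dots> = (\<integral>\<^sup>+h\<in>annulus (1 / 2) 1. ennreal (norm (h::'a) powr \<beta>) \<partial>lborel)
        + (\<integral>\<^sup>+h\<in>annulus (1 / 2 * (1 / 2) ^ n) (1 / 2 * 1). ennreal (norm (h::'a) powr \<beta>) \<partial>lborel)"
      by (rule nn_integral_add) measurable
    also have "\<dots> \<le> ennreal (2 ^ DIM('a) * (unit_ball_vol (real DIM('a)) * 1 ^ DIM('a)))
        + ennreal (2 powr - \<tau>) * (\<integral>\<^sup>+h\<in>A n. ennreal (norm h powr \<beta>) \<partial>lborel)"
    proof (intro add_mono nn_integral_annulus_le)
      show "norm h powr \<beta> \<le> 2 ^ DIM('a)" if "h \<in> annulus (1 / 2) 1" for h :: 'a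
      proof -
        have h: "1 / 2 \<le> norm h" "norm h < 1" "h \<noteq> 0"
          using that by (auto simp: annulus_def)
        have "norm h powr \<beta> = norm h powr \<tau> * (1 / norm h) ^ DIM('a)"
          using h by (simp add: \<beta>_def powr_diff powr_realpow power_divide)
        also have "\<dots> \<le> 1 * 2 ^ DIM('a)"
          using h assms by (intro mult_mono power_mono powr_le1) (auto simp: field_simps)
        finally show ?thesis by simp
      qed
      have "(1 / 2 :: real) powr \<tau> = 2 powr - \<tau>"
        by (simp add: powr_divide powr_minus_divide)
      then show "(\<integral>\<^sup>+h\<in>annulus (1 / 2 * (1 / 2) ^ n) (1 / 2 * 1). ennreal (norm (h::'a) powr \<beta>) \<partial>lborel)
          \<le> ennreal (2 powr - \<tau>) * (\<integral>\<^sup>+h\<in>A n. ennreal (norm h powr \<beta>) \<partial>lborel)"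
        by (subst radial_power_dilation) (auto simp: A_def \<beta>_def)
    qed auto
    finally show "(\<integral>\<^sup>+h\<in>A (Suc n). ennreal (norm h powr \<beta>) \<partial>lborel)
        \<le> ennreal (unit_ball_vol (real DIM('a)) * 2 ^ DIM('a))
        + ennreal (2 powr - \<tau>) * (\<integral>\<^sup>+h\<in>A n. ennreal (norm h powr \<beta>) \<partial>lborel)"
      by (simp add: mult_ac)
  qed (use assms powr_less_mono[of "- \<tau>" 0 2] in \<open>auto simp: A_def\<close>)
  moreover have "(\<integral>\<^sup>+h\<in>{h. norm h < 1}. ennreal (norm (h::'a) powr \<beta>) \<partial>lborel)
      = (\<integral>\<^sup>+h\<in>(\<Union>n. A n). ennreal (norm h powr \<beta>) \<partial>lborel)"
    unfolding UN by (intro nn_integral_cong) (auto simp: indicator_def)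
  ultimately show ?thesis
    unfolding \<beta>_def by simp
qed

text \<open>
  The region outside the ball of radius \<open>2\<close> is a dilate of the one outside the unit ball, hence \<open>I = S + 2 powr (- \<sigma>) I\<close>
  for the integral \<open>S\<close> over the shell between them; finally \<open>1 - 2 powr (- \<sigma>) \<le> \<sigma>\<close>.
\<close>

lemma nn_integral_far_ge:
  assumes "0 < \<sigma>"
  shows "ennreal (unit_ball_vol (real DIM('a)) * 2 powr - (real DIM('a) + \<sigma>) / \<sigma>)
    \<le> (\<integral>\<^sup>+h\<in>{h. 1 \<le> norm h}. ennreal (norm (h::'a::euclidean_space) powr - (real DIM('a) + \<sigma>)) \<partial>lborel)"
proof -
  define \<omega> where "\<omega> = unit_ball_vol (real DIM('a))"
  define \<beta> where "\<beta> = - (real DIM('a) + \<sigma>)"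
  define F :: "'a set \<Rightarrow> ennreal"
    where "F X = (\<integral>\<^sup>+h\<in>X. ennreal (norm h powr \<beta>) \<partial>lborel)" for X
  have \<omega>: "0 < \<omega>" unfolding \<omega>_def by (rule unit_ball_vol_pos) simp
  have set_F: "F X = emeasure (density lborel (\<lambda>h. ennreal (norm h powr \<beta>))) X"
    if "X \<in> sets borel" for X
    using that by (simp add: F_def emeasure_density)
  have far: "F {h. 2 \<le> norm h} = ennreal (2 powr - \<sigma>) * F {h. 1 \<le> norm h}"
  proof -
    have "F {h. 2 \<le> norm h} = ennreal (2 ^ DIM('a)) *
        (\<integral>\<^sup>+h. ennreal (norm (0 + 2 *\<^sub>R (h::'a)) powr \<beta>) * indicator {h. 2 \<le> norm h} (0 + 2 *\<^sub>R h) \<partial>lborel)"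
      unfolding F_def by (rule nn_integral_lborel_affine) measurable
    also have "(\<integral>\<^sup>+h. ennreal (norm (0 + 2 *\<^sub>R (h::'a)) powr \<beta>) * indicator {h. 2 \<le> norm h} (0 + 2 *\<^sub>R h) \<partial>lborel)
        = (\<integral>\<^sup>+h. ennreal (2 powr \<beta>) * (ennreal (norm (h::'a) powr \<beta>) * indicator {h. 1 \<le> norm h} h) \<partial>lborel)"
      by (intro nn_integral_cong) (auto simp: indicator_def powr_mult ennreal_mult')
    also have "\<dots> = ennreal (2 powr \<beta>) * F {h. 1 \<le> norm h}"
      unfolding F_def by (rule nn_integral_cmult) measurable
    finally have "F {h. 2 \<le> norm h} = ennreal (2 ^ DIM('a) * 2 powr \<beta>) * F {h. 1 \<le> norm h}"
      by (simp add: ennreal_mult' mult_ac)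
    also have "(2::real) ^ DIM('a) * 2 powr \<beta> = 2 powr - \<sigma>"
      by (simp add: \<beta>_def powr_realpow[symmetric] flip: powr_add)
    finally show ?thesis .
  qed
  have shell: "ennreal (\<omega> * 2 powr \<beta>) \<le> F (annulus 1 2)"
  proof -
    have ann: "annulus 1 2 = ball 0 2 - ball (0::'a) 1"
      by (auto simp: annulus_def)
    have "emeasure lborel (annulus 1 2 :: 'a set) = ennreal (\<omega> * 2 ^ DIM('a)) - ennreal \<omega>"
      unfolding ann by (subst emeasure_Diff) (auto simp: emeasure_ball \<omega>_def)
    also have "\<dots> = ennreal (\<omega> * 2 ^ DIM('a) - \<omega>)"
      using \<omega> by (intro ennreal_minus) simp
    finally have vol: "emeasure lborel (annulus 1 2 :: 'a set) = ennreal (\<omega> * 2 ^ DIM('a) - \<omega>)" .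
    have "(2::real) ^ 1 \<le> 2 ^ DIM('a)"
      by (intro power_increasing) (auto simp: Suc_le_eq)
    then have "\<omega> * 2 \<le> \<omega> * 2 ^ DIM('a)"
      using \<omega> by simp
    then have "ennreal (\<omega> * 2 powr \<beta>) \<le> ennreal (2 powr \<beta>) * emeasure lborel (annulus 1 2 :: 'a set)"
      unfolding vol by (subst ennreal_mult'[symmetric]) (auto intro!: ennreal_leI simp: mult.commute)
    also have "\<dots> = (\<integral>\<^sup>+h\<in>annulus 1 2. ennreal (2 powr \<beta>) \<partial>(lborel :: 'a measure))"
      by (rule nn_integral_cmult_indicator[symmetric]) simp
    also have "\<dots> \<le> F (annulus 1 2)"
      unfolding F_def using assms
      by (intro nn_integral_mono)
        (auto simp: annulus_def indicator_def \<beta>_def intro!: ennreal_leI powr_mono2')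
    finally show ?thesis .
  qed
  have un: "{h::'a. 1 \<le> norm h} = annulus 1 2 \<union> {h. 2 \<le> norm h}"
    by (auto simp: annulus_def)
  have split: "F {h. 1 \<le> norm h} = F (annulus 1 2) + F {h. 2 \<le> norm h}"
    unfolding un by (subst (1 2 3) set_F) (auto intro!: plus_emeasure[symmetric] simp: annulus_def)
  have "F {h. 1 \<le> norm h} < \<infinity>"
    unfolding F_def \<beta>_def using nn_integral_far_le[OF assms] by (rule order.strict_trans1) simp
  then obtain I where I: "F {h. 1 \<le> norm h} = ennreal I" "0 \<le> I"
    by (cases "F {h. 1 \<le> norm h}") auto
  have "ennreal (\<omega> * 2 powr \<beta> + 2 powr - \<sigma> * I) \<le> ennreal I"
    using shell split unfolding far I(1)
    by (metis \<omega> I(2) add_right_mono ennreal_mult' ennreal_plus less_imp_le mult_nonneg_nonneg powr_ge_zero)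
  then have "\<omega> * 2 powr \<beta> \<le> (1 - 2 powr - \<sigma>) * I"
    using I(2) by (simp add: algebra_simps)
  also have "\<dots> \<le> \<sigma> * I"
    using one_minus_two_powr_le[of \<sigma>] assms I(2) by (intro mult_right_mono) auto
  finally have "\<omega> * 2 powr \<beta> / \<sigma> \<le> I"
    using assms by (simp add: field_simps)
  then show ?thesis
    using I unfolding F_def \<omega>_def \<beta>_def by (auto intro: ennreal_leI)
qed

section \<open>Averages and the Gagliardo kernel\<close>

lemma convex_on_abs_powr:
  fixes p :: real
  assumes "1 \<le> p"
  shows "convex_on UNIV (\<lambda>x::real. \<bar>x\<bar> powr p)"
proof (rule convex_onI)
  fix t x y :: real
  assume t: "0 < t" "t < 1"
  have shrink: "c powr p \<le> c" if "0 < c" "c < 1" for c :: real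
    using powr_mono'[of 1 p c] that assms by auto
  have "\<bar>(1 - t) *\<^sub>R x + t *\<^sub>R y\<bar> powr p \<le> ((1 - t) * \<bar>x\<bar> + t * \<bar>y\<bar>) powr p"
    using t assms abs_triangle_ineq[of "(1 - t) * x" "t * y"]
    by (intro powr_mono2) (auto simp: abs_mult)
  also have "\<dots> \<le> (1 - t) * \<bar>x\<bar> powr p + t * \<bar>y\<bar> powr p"
  proof (cases "x = 0 \<or> y = 0")
    case True
    then show ?thesis
      using t shrink[of t] shrink[of "1 - t"] assms by (auto simp: powr_mult intro!: mult_right_mono)
  next
    case False
    then show ?thesis
      using convex_onD[OF powr_convex[OF assms], of t "\<bar>x\<bar>" "\<bar>y\<bar>"] t by auto
  qed
  finally show "\<bar>(1 - t) *\<^sub>R x + t *\<^sub>R y\<bar> powr p \<le> (1 - t) * \<bar>x\<bar> powr p + t * \<bar>y\<bar> powr p" .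
qed simp

text \<open>
  The constant is the one of convexity. It has to be sharp: the midpoint argument for \<open>s\<close> near \<open>1\<close> would fail with
  \<open>2 powr p\<close> in place of \<open>2 powr (p - 1)\<close>.
\<close>

lemma abs_add_powr_le:
  fixes p a b :: real
  assumes "1 \<le> p"
  shows "\<bar>a + b\<bar> powr p \<le> 2 powr (p - 1) * (\<bar>a\<bar> powr p + \<bar>b\<bar> powr p)"
proof -
  have "\<bar>a + b\<bar> powr p = 2 powr p * \<bar>(1 - 1 / 2) *\<^sub>R a + (1 / 2) *\<^sub>R b\<bar> powr p"
    by (simp add: powr_divide flip: add_divide_distrib)
  also have "\<dots> \<le> 2 powr p * ((1 - 1 / 2) * \<bar>a\<bar> powr p + 1 / 2 * \<bar>b\<bar> powr p)"
    by (intro mult_left_mono convex_onD[OF convex_on_abs_powr[OF assms]]) auto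
  also have "\<dots> = 2 powr (p - 1) * (\<bar>a\<bar> powr p + \<bar>b\<bar> powr p)"
    by (simp add: powr_diff algebra_simps)
  finally show ?thesis .
qed

text \<open>
  Jensen's inequality for the uniform distribution on the ball.
\<close>

lemma abs_average_powr_le:
  fixes v :: "'a::euclidean_space \<Rightarrow> real"
  assumes p: "1 \<le> p" and v: "continuous_on UNIV v" and "0 < r"
  shows "ennreal (\<bar>a - av v (ball x0 r)\<bar> powr p) * emeasure lborel (ball x0 r)
    \<le> (\<integral>\<^sup>+y\<in>ball x0 r. ennreal (\<bar>a - v y\<bar> powr p) \<partial>lborel)"
proof -
  define B where "B = ball x0 r"
  define M where "M = uniform_measure lborel B"
  have [measurable]: "v \<in> borel_measurable borel"
    using v by (rule borel_measurable_continuous_onI)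
  have [measurable]: "B \<in> sets borel"
    by (simp add: B_def)
  have B0: "0 < measure lborel B"
    using assms(3) by (simp add: B_def content_ball unit_ball_vol_pos)
  have Bfin: "emeasure lborel B = ennreal (measure lborel B)"
    using assms(3) by (simp add: B_def emeasure_ball content_ball)
  interpret prob_space M
    unfolding M_def by (rule prob_space_uniform_measure) (use B0 Bfin in auto)
  have M_dens: "M = density lborel (\<lambda>x. ennreal (indicator B x / measure lborel B))"
    unfolding M_def uniform_measure_def Bfin using B0
    by (intro density_cong) (auto simp: indicator_def divide_ennreal simp flip: ennreal_1)
  have bdd: "\<exists>K. \<forall>y\<in>B. \<bar>v y\<bar> \<le> K"
  proof -
    have "compact (v ` cball x0 r)"
      by (intro compact_continuous_image continuous_on_subset[OF v]) auto
    then obtain K where "\<forall>z\<in>v ` cball x0 r. norm z \<le> K"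
      using bounded_iff compact_imp_bounded by blast
    then show ?thesis
      by (auto simp: B_def intro!: exI[of _ K])
  qed
  then obtain K where K: "\<And>y. y \<in> B \<Longrightarrow> \<bar>v y\<bar> \<le> K"
    by blast
  have inB: "AE y in M. y \<in> B"
    unfolding M_def by (rule AE_uniform_measureI) auto
  have int_v: "integrable M v"
    by (rule integrable_const_bound[where B = K]) (use inB K in \<open>auto simp: M_def\<close>)
  have avg: "expectation v = av v B"
    unfolding M_dens av_def set_lebesgue_integral_def
    by (subst integral_real_density) (use B0 in \<open>auto simp: indicator_def\<close>)
  have int_p: "integrable M (\<lambda>y. \<bar>a - v y\<bar> powr p)"
  proof (rule integrable_const_bound[where B = "(\<bar>a\<bar> + K) powr p"])
    show "AE y in M. norm (\<bar>a - v y\<bar> powr p) \<le> (\<bar>a\<bar> + K) powr p"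
      using inB
    proof eventually_elim
      case (elim y)
      show ?case
        using K[OF elim] p by (auto intro!: powr_mono2)
    qed
  qed (auto simp: M_def)
  have "\<bar>expectation (\<lambda>y. a - v y)\<bar> powr p \<le> expectation (\<lambda>y. \<bar>a - v y\<bar> powr p)"
    by (rule jensens_inequality[where I = UNIV])
      (use int_v int_p convex_on_abs_powr[OF p] in auto)
  also have "expectation (\<lambda>y. a - v y) = a - av v B"
    using int_v by (simp add: avg[symmetric] prob_space)
  finally have "ennreal (\<bar>a - av v B\<bar> powr p) \<le> (\<integral>\<^sup>+y. ennreal (\<bar>a - v y\<bar> powr p) \<partial>M)"
    using int_p by (subst nn_integral_eq_integral) (auto intro: ennreal_leI)
  also have "\<dots> = (\<integral>\<^sup>+y\<in>B. ennreal (\<bar>a - v y\<bar> powr p) \<partial>lborel) / emeasure lborel B"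
    unfolding M_def by (rule nn_integral_uniform_measure) auto
  finally have "ennreal (\<bar>a - av v B\<bar> powr p) * emeasure lborel B
      \<le> (\<integral>\<^sup>+y\<in>B. ennreal (\<bar>a - v y\<bar> powr p) \<partial>lborel) / emeasure lborel B * emeasure lborel B"
    by (rule mult_right_mono) simp
  also have "\<dots> = (\<integral>\<^sup>+y\<in>B. ennreal (\<bar>a - v y\<bar> powr p) \<partial>lborel)"
    using B0 unfolding Bfin by (intro ennreal_divide_times[THEN trans] mult_divide_eq_ennreal) auto
  finally show ?thesis
    unfolding B_def .
qed

text \<open>
  At \<open>x = y\<close> the value is \<open>0 / 0 = 0\<close>, so that the diagonal needs no separate treatment.
\<close>

definition gagliardo_kernel ::
    "real \<Rightarrow> real \<Rightarrow> ('a::euclidean_space \<Rightarrow> real) \<Rightarrow> 'a \<Rightarrow> 'a \<Rightarrow> real" where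
  "gagliardo_kernel s p u x y = \<bar>u x - u y\<bar> powr p / norm (x - y) powr (real DIM('a) + s * p)"

lemma gagliardo_kernel_measurable [measurable (raw)]:
  fixes u :: "'a::euclidean_space \<Rightarrow> real"
  assumes [measurable]: "u \<in> borel_measurable borel" "f \<in> borel_measurable M" "g \<in> borel_measurable M"
  shows "(\<lambda>x. gagliardo_kernel s p u (f x) (g x)) \<in> borel_measurable M"
  unfolding gagliardo_kernel_def by measurable

lemma gagliardo_kernel_nonneg: "0 \<le> gagliardo_kernel s p u x y"
  by (simp add: gagliardo_kernel_def)

lemma gagliardo_kernel_commute: "gagliardo_kernel s p u x y = gagliardo_kernel s p u y x"
  by (simp add: gagliardo_kernel_def abs_minus_commute norm_minus_commute)

lemma gagliardo_iterated:
  fixes u :: "'a::euclidean_space \<Rightarrow> real"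
  assumes [measurable]: "u \<in> borel_measurable borel" "A \<in> sets borel" "B \<in> sets borel"
  shows "gagliardo s p A B u
    = (\<integral>\<^sup>+x. (\<integral>\<^sup>+y. ennreal (gagliardo_kernel s p u x y) * indicator A x * indicator B y \<partial>lborel) \<partial>lborel)"
proof -
  have "gagliardo s p A B u = (\<integral>\<^sup>+z. ennreal (gagliardo_kernel s p u (fst z) (snd z)) *
      indicator A (fst z) * indicator B (snd z) \<partial>(lborel \<Otimes>\<^sub>M lborel))"
    unfolding gagliardo_def gagliardo_kernel_def[symmetric]
    by (intro nn_integral_cong) (auto simp: indicator_def)
  also have "\<dots> = (\<integral>\<^sup>+x. (\<integral>\<^sup>+y. ennreal (gagliardo_kernel s p u x y) * indicator A x * indicator B y \<partial>lborel) \<partial>lborel)"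
    by (subst lborel.nn_integral_fst[symmetric]) auto
  finally show ?thesis .
qed

lemma gagliardo_mono:
  assumes "A \<subseteq> A'" "B \<subseteq> B'"
  shows "gagliardo s p A B u \<le> gagliardo s p A' B' u"
  unfolding gagliardo_def using assms by (intro nn_integral_mono) (auto simp: indicator_def)

text \<open>
  Rescaling \<open>y = x + h / L\<close> reduces to \<open>L = 1\<close>. For \<open>\<bar>h\<bar> < 1\<close> the Lipschitz bound leaves the power
  \<open>(1 - s) p - N\<close>, whose integral costs \<open>1 / (1 - s)\<close>; for \<open>\<bar>h\<bar> \<ge> 1\<close> boundedness leaves the power
  \<open>- N - s p\<close>, whose integral costs \<open>1 / s\<close>.
\<close>

lemma nn_integral_kernel_lipschitz_le:
  fixes f :: "'a::euclidean_space \<Rightarrow> real"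
  assumes [measurable]: "f \<in> borel_measurable borel"
    and bound: "\<And>y. \<bar>f x - f y\<bar> \<le> 1" and lip: "\<And>y. \<bar>f x - f y\<bar> \<le> L * norm (x - y)"
    and "0 < L" and p: "1 \<le> p" and s: "0 < s" "s < 1"
  shows "(\<integral>\<^sup>+y. ennreal (gagliardo_kernel s p f x y) \<partial>lborel)
    \<le> ennreal (L powr (s * p) * (unit_ball_vol (real DIM('a)) * 2 ^ Suc DIM('a) / (s * (1 - s))))"
proof -
  define \<omega> where "\<omega> = unit_ball_vol (real DIM('a)) * 2 ^ DIM('a)"
  define \<gamma> where "\<gamma> = real DIM('a) + s * p"
  have "0 \<le> \<omega>"
    by (simp add: \<omega>_def)
  have pointwise: "ennreal (gagliardo_kernel s p f x (x + (1 / L) *\<^sub>R h))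
      \<le> ennreal (L powr \<gamma>) * (ennreal (norm h powr ((1 - s) * p - real DIM('a))) * indicator {h. norm h < 1} h
        + ennreal (norm h powr - \<gamma>) * indicator {h. 1 \<le> norm h} h)" for h
  proof (cases "h = 0")
    case False
    have eq: "gagliardo_kernel s p f x (x + (1 / L) *\<^sub>R h)
        = L powr \<gamma> * (\<bar>f x - f (x + (1 / L) *\<^sub>R h)\<bar> powr p * norm h powr - \<gamma>)"
      using \<open>0 < L\<close> by (simp add: gagliardo_kernel_def \<gamma>_def[symmetric] powr_divide powr_minus_divide)
    show ?thesis
    proof (cases "norm h < 1")
      case True
      have "\<bar>f x - f (x + (1 / L) *\<^sub>R h)\<bar> powr p \<le> norm h powr p"
        using lip[of "x + (1 / L) *\<^sub>R h"] \<open>0 < L\<close> p by (intro powr_mono2) auto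
      then have "\<bar>f x - f (x + (1 / L) *\<^sub>R h)\<bar> powr p * norm h powr - \<gamma> \<le> norm h powr p * norm h powr - \<gamma>"
        by (rule mult_right_mono) simp
      also have "\<dots> = norm h powr ((1 - s) * p - real DIM('a))"
        by (simp add: \<gamma>_def algebra_simps flip: powr_add)
      finally have "ennreal (gagliardo_kernel s p f x (x + (1 / L) *\<^sub>R h))
          \<le> ennreal (L powr \<gamma> * norm h powr ((1 - s) * p - real DIM('a)))"
        unfolding eq by (intro ennreal_leI mult_left_mono) auto
      then show ?thesis
        using True by (simp add: ennreal_mult')
    next
      case far: False
      have "\<bar>f x - f (x + (1 / L) *\<^sub>R h)\<bar> powr p \<le> 1 powr p"
        using bound[of "x + (1 / L) *\<^sub>R h"] p by (intro powr_mono2) auto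
      then have "\<bar>f x - f (x + (1 / L) *\<^sub>R h)\<bar> powr p * norm h powr - \<gamma> \<le> 1 * norm h powr - \<gamma>"
        by (intro mult_right_mono) auto
      then have "ennreal (gagliardo_kernel s p f x (x + (1 / L) *\<^sub>R h)) \<le> ennreal (L powr \<gamma> * norm h powr - \<gamma>)"
        unfolding eq by (intro ennreal_leI mult_left_mono) auto
      then show ?thesis
        using far by (simp add: ennreal_mult')
    qed
  qed (simp add: gagliardo_kernel_def)
  have near: "(\<integral>\<^sup>+h\<in>{h. norm h < 1}. ennreal (norm (h::'a) powr ((1 - s) * p - real DIM('a))) \<partial>lborel)
      \<le> ennreal (\<omega> * 2 / (1 - s))"
  proof -
    have "(1 - s) / 2 \<le> 1 - 2 powr - ((1 - s) * p)"
      using two_powr_minus_le[OF p, of "1 - s"] s by simp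
    then have "\<omega> / (1 - 2 powr - ((1 - s) * p)) \<le> \<omega> / ((1 - s) / 2)"
      using s \<open>0 \<le> \<omega>\<close> by (intro divide_left_mono) auto
    then show ?thesis
      using s p unfolding \<omega>_def
      by (intro order_trans[OF nn_integral_near_le]) (auto intro!: ennreal_leI)
  qed
  have far: "(\<integral>\<^sup>+h\<in>{h. 1 \<le> norm h}. ennreal (norm (h::'a) powr - \<gamma>) \<partial>lborel) \<le> ennreal (\<omega> * 2 / s)"
  proof -
    have "s / 2 \<le> 1 - 2 powr - (s * p)"
      using two_powr_minus_le[OF p, of s] s by simp
    then have "\<omega> / (1 - 2 powr - (s * p)) \<le> \<omega> / (s / 2)"
      using s \<open>0 \<le> \<omega>\<close> by (intro divide_left_mono) auto
    then show ?thesis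
      using s p unfolding \<omega>_def \<gamma>_def
      by (intro order_trans[OF nn_integral_far_le]) (auto intro!: ennreal_leI)
  qed
  have "(\<integral>\<^sup>+y. ennreal (gagliardo_kernel s p f x y) \<partial>lborel)
      = ennreal ((1 / L) ^ DIM('a)) * (\<integral>\<^sup>+h. ennreal (gagliardo_kernel s p f x (x + (1 / L) *\<^sub>R h)) \<partial>lborel)"
    using \<open>0 < L\<close> by (intro nn_integral_lborel_affine) auto
  also have "\<dots> \<le> ennreal ((1 / L) ^ DIM('a)) *
      (\<integral>\<^sup>+h. ennreal (L powr \<gamma>) * (ennreal (norm h powr ((1 - s) * p - real DIM('a))) * indicator {h. norm h < 1} h
        + ennreal (norm h powr - \<gamma>) * indicator {h. 1 \<le> norm h} h) \<partial>(lborel :: 'a measure))"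
    by (intro mult_left_mono nn_integral_mono pointwise) simp
  also have "\<dots> = ennreal ((1 / L) ^ DIM('a)) * (ennreal (L powr \<gamma>) *
      ((\<integral>\<^sup>+h\<in>{h. norm h < 1}. ennreal (norm (h::'a) powr ((1 - s) * p - real DIM('a))) \<partial>lborel)
        + (\<integral>\<^sup>+h\<in>{h. 1 \<le> norm h}. ennreal (norm (h::'a) powr - \<gamma>) \<partial>lborel)))"
    by (simp add: nn_integral_cmult nn_integral_add)
  also have "\<dots> \<le> ennreal ((1 / L) ^ DIM('a)) * (ennreal (L powr \<gamma>) *
      (ennreal (\<omega> * 2 / (1 - s)) + ennreal (\<omega> * 2 / s)))"
    by (intro mult_left_mono add_mono near far) auto
  also have "\<dots> = ennreal ((1 / L) ^ DIM('a) * L powr \<gamma> * (\<omega> * 2 / (1 - s) + \<omega> * 2 / s))"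
    using s \<open>0 \<le> \<omega>\<close> \<open>0 < L\<close> by (simp add: ennreal_mult' mult_ac flip: ennreal_plus)
  also have "(1 / L) ^ DIM('a) * L powr \<gamma> = L powr (s * p)"
    using \<open>0 < L\<close> by (simp add: \<gamma>_def powr_add powr_realpow power_divide)
  also have "\<omega> * 2 / (1 - s) + \<omega> * 2 / s = \<omega> * 2 / (s * (1 - s))"
    using s by (simp add: field_simps)
  finally show ?thesis
    by (simp add: \<omega>_def mult_ac)
qed

section \<open>Two fractional Poincare inequalities\<close>

definition oscillation :: "real \<Rightarrow> ('a::euclidean_space \<Rightarrow> real) \<Rightarrow> ennreal" where
  "oscillation p v = (\<integral>\<^sup>+x. (\<integral>\<^sup>+y. ennreal (\<bar>v x - v y\<bar> powr p) *
     indicator (ball 0 1) x * indicator (ball 0 1) y \<partial>lborel) \<partial>lborel)"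

text \<open>
  For \<open>x\<close>, \<open>x'\<close> in the unit ball and \<open>\<bar>y\<bar> \<ge> 1\<close> one has \<open>\<bar>x - y\<bar> \<le> 2 \<bar>y\<bar>\<close>, so \<open>\<bar>y\<bar> powr (- \<gamma>)\<close> is
  at most \<open>2 powr \<gamma>\<close> times \<open>\<bar>x - y\<bar> powr (- \<gamma>)\<close>, and likewise for \<open>x'\<close>. Integrating
  \<open>\<bar>v x - v x'\<bar>\<^sup>p \<le> 2 powr (p - 1) (\<bar>v x - v y\<bar>\<^sup>p + \<bar>v x' - v y\<bar>\<^sup>p)\<close> against this weight gives the oscillation times
  a mass of order \<open>1 / s\<close> on the left.
\<close>

lemma oscillation_le_far:
  fixes v :: "'a::euclidean_space \<Rightarrow> real"
  assumes [measurable]: "v \<in> borel_measurable borel" and p: "1 \<le> p" and s: "0 < s"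
  shows "oscillation p v
    \<le> ennreal (s * p * 2 powr (p + 2 * (real DIM('a) + s * p))) * gagliardo s p (ball 0 1) UNIV v"
proof -
  define B where "B = ball (0::'a) 1"
  have [measurable]: "B \<in> sets borel"
    by (simp add: B_def)
  define \<omega> where "\<omega> = unit_ball_vol (real DIM('a))"
  have \<omega>: "0 < \<omega>" "emeasure lborel B = ennreal \<omega>"
    by (auto simp: \<omega>_def B_def emeasure_ball unit_ball_vol_pos)
  define \<gamma> where "\<gamma> = real DIM('a) + s * p"
  have \<gamma>: "0 < \<gamma>"
    using s p by (simp add: \<gamma>_def add_pos_pos)
  define k where "k y = ennreal (norm y powr - \<gamma>) * indicator {y. 1 \<le> norm y} y" for y :: 'a
  have [measurable]: "k \<in> borel_measurable borel"
    unfolding k_def by measurable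
  define I where "I = (\<integral>\<^sup>+y. k y \<partial>lborel)"
  define K where "K x y = ennreal (gagliardo_kernel s p v x y)" for x y
  have [measurable]: "(\<lambda>(x, y). K x y) \<in> borel_measurable (lborel \<Otimes>\<^sub>M lborel)"
    unfolding K_def by measurable
  define g where "g x = (\<integral>\<^sup>+y. K x y \<partial>lborel)" for x
  have [measurable]: "g \<in> borel_measurable borel"
    unfolding g_def by measurable
  define G where "G = (\<integral>\<^sup>+x. g x * indicator B x \<partial>lborel)"
  have G: "gagliardo s p B UNIV v = G"
    by (subst gagliardo_iterated)
      (auto simp: G_def g_def K_def nn_integral_multc intro!: nn_integral_cong)
  define C where "C = 2 powr (p - 1 + \<gamma>)"
  have C: "0 < C" by (simp add: C_def)
  have pointwise: "ennreal (\<bar>v x - v x'\<bar> powr p) * k y \<le> ennreal C * (K x y + K x' y)"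
    if x: "x \<in> B" and x': "x' \<in> B" for x x' y
  proof (cases "1 \<le> norm y")
    case True
    have compare: "norm y powr - \<gamma> * \<bar>v z - v y\<bar> powr p \<le> 2 powr \<gamma> * gagliardo_kernel s p v z y"
      if "z \<in> B" for z
    proof (cases "z = y")
      case False
      have "norm (z - y) \<le> 2 * norm y"
        using norm_triangle_ineq4[of z y] that True by (simp add: B_def)
      then have "(2 * norm y) powr - \<gamma> \<le> norm (z - y) powr - \<gamma>"
        using False \<gamma> by (intro powr_mono2') auto
      then have "2 powr - \<gamma> * norm y powr - \<gamma> \<le> norm (z - y) powr - \<gamma>"
        by (simp add: powr_mult)
      then have "2 powr \<gamma> * (2 powr - \<gamma> * norm y powr - \<gamma>) \<le> 2 powr \<gamma> * norm (z - y) powr - \<gamma>"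
        by (intro mult_left_mono) auto
      moreover have "2 powr \<gamma> * (2 powr - \<gamma> * norm y powr - \<gamma>) = norm y powr - \<gamma>"
        by (simp add: powr_minus)
      ultimately have "norm y powr - \<gamma> \<le> 2 powr \<gamma> * norm (z - y) powr - \<gamma>"
        by simp
      then have "norm y powr - \<gamma> * \<bar>v z - v y\<bar> powr p \<le> 2 powr \<gamma> * norm (z - y) powr - \<gamma> * \<bar>v z - v y\<bar> powr p"
        by (rule mult_right_mono) simp
      also have "\<dots> = 2 powr \<gamma> * gagliardo_kernel s p v z y"
        by (simp add: gagliardo_kernel_def \<gamma>_def[symmetric] powr_minus_divide)
      finally show ?thesis .
    qed (simp add: gagliardo_kernel_def)
    have "\<bar>v x - v x'\<bar> powr p * norm y powr - \<gamma>
        \<le> 2 powr (p - 1) * (\<bar>v x - v y\<bar> powr p + \<bar>v x' - v y\<bar> powr p) * norm y powr - \<gamma>"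
      using abs_add_powr_le[OF p, of "v x - v y" "v y - v x'"]
      by (intro mult_right_mono) (auto simp: abs_minus_commute)
    also have "\<dots> = 2 powr (p - 1) * (norm y powr - \<gamma> * \<bar>v x - v y\<bar> powr p + norm y powr - \<gamma> * \<bar>v x' - v y\<bar> powr p)"
      by (simp add: algebra_simps)
    also have "\<dots> \<le> 2 powr (p - 1) * (2 powr \<gamma> * gagliardo_kernel s p v x y + 2 powr \<gamma> * gagliardo_kernel s p v x' y)"
      by (intro mult_left_mono add_mono compare x x') auto
    also have "\<dots> = C * (gagliardo_kernel s p v x y + gagliardo_kernel s p v x' y)"
      unfolding C_def powr_add by (simp add: algebra_simps)
    finally have "ennreal (\<bar>v x - v x'\<bar> powr p * norm y powr - \<gamma>)
        \<le> ennreal (C * (gagliardo_kernel s p v x y + gagliardo_kernel s p v x' y))"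
      by (rule ennreal_leI)
    then show ?thesis
      using True C by (simp add: k_def K_def ennreal_mult' gagliardo_kernel_nonneg)
  qed (simp add: k_def)
  have step: "ennreal (\<bar>v x - v x'\<bar> powr p) * I \<le> ennreal C * (g x + g x')"
    if x: "x \<in> B" and x': "x' \<in> B" for x x'
  proof -
    have "ennreal (\<bar>v x - v x'\<bar> powr p) * I = (\<integral>\<^sup>+y. ennreal (\<bar>v x - v x'\<bar> powr p) * k y \<partial>lborel)"
      unfolding I_def by (rule nn_integral_cmult[symmetric]) measurable
    also have "\<dots> \<le> (\<integral>\<^sup>+y. ennreal C * (K x y + K x' y) \<partial>lborel)"
      by (intro nn_integral_mono pointwise x x')
    also have "\<dots> = ennreal C * (g x + g x')"
      unfolding g_def K_def by (simp add: nn_integral_cmult nn_integral_add)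
    finally show ?thesis .
  qed
  have "oscillation p v * I = (\<integral>\<^sup>+x. (\<integral>\<^sup>+x'. I * (ennreal (\<bar>v x - v x'\<bar> powr p) *
      indicator B x * indicator B x') \<partial>lborel) \<partial>lborel)"
    unfolding oscillation_def B_def[symmetric] by (subst mult.commute) (simp add: nn_integral_cmult)
  also have "\<dots> = (\<integral>\<^sup>+x. (\<integral>\<^sup>+x'. ennreal (\<bar>v x - v x'\<bar> powr p) * I *
      indicator B x * indicator B x' \<partial>lborel) \<partial>lborel)"
    by (simp add: mult_ac)
  also have "\<dots> \<le> (\<integral>\<^sup>+x. (\<integral>\<^sup>+x'. ennreal C * ((g x * indicator B x) * indicator B x'
      + indicator B x * (g x' * indicator B x')) \<partial>lborel) \<partial>lborel)"
    by (intro nn_integral_mono) (use step in \<open>auto simp: indicator_def\<close>)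
  also have "\<dots> = ennreal C * (G * ennreal \<omega> + ennreal \<omega> * G)"
    by (simp add: nn_integral_cmult nn_integral_add nn_integral_multc \<omega>(2) G_def[symmetric])
  also have "\<dots> = ennreal (2 * C * \<omega>) * G"
    using C \<omega>(1) by (simp add: ennreal_mult' mult_ac flip: mult_2)
  finally have upper: "oscillation p v * I \<le> ennreal (2 * C * \<omega>) * G" .
  define c where "c = \<omega> * 2 powr - \<gamma> / (s * p)"
  have c: "0 < c"
    using \<omega> s p by (simp add: c_def)
  have "ennreal c \<le> I"
    unfolding I_def k_def c_def \<omega>_def \<gamma>_def by (rule nn_integral_far_ge) (use s p in simp)
  then have "oscillation p v * ennreal c \<le> ennreal (2 * C * \<omega>) * G"
    using upper by (meson mult_left_mono order_trans zero_le)
  then have "oscillation p v * ennreal c * ennreal (1 / c) \<le> ennreal (2 * C * \<omega>) * G * ennreal (1 / c)"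
    by (rule mult_right_mono) simp
  moreover have "oscillation p v * ennreal c * ennreal (1 / c) = oscillation p v"
    using c by (simp add: mult.assoc flip: ennreal_mult')
  moreover have "ennreal (2 * C * \<omega>) * G * ennreal (1 / c) = ennreal (2 * C * \<omega> / c) * G"
  proof -
    have "ennreal (2 * C * \<omega>) * G * ennreal (1 / c) = (ennreal (2 * C * \<omega>) * ennreal (1 / c)) * G"
      by (simp only: mult_ac)
    also have "ennreal (2 * C * \<omega>) * ennreal (1 / c) = ennreal (2 * C * \<omega> * (1 / c))"
      by (rule ennreal_mult'[symmetric]) (use C \<omega>(1) in simp)
    finally show ?thesis by simp
  qed
  moreover have "2 * C * \<omega> / c = s * p * 2 powr (p + 2 * \<gamma>)"
  proof -
    have "2 * C = 2 powr (p + \<gamma>)"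
      by (simp add: C_def powr_diff powr_add)
    moreover have "1 / c = s * p * 2 powr \<gamma> / \<omega>"
      using \<omega>(1) s p by (simp add: c_def powr_minus field_simps)
    ultimately have "2 * C * \<omega> * (1 / c) = s * p * (2 powr (p + \<gamma>) * 2 powr \<gamma>)"
      using \<omega>(1) by simp
    also have "2 powr (p + \<gamma>) * 2 powr \<gamma> = 2 powr (p + 2 * \<gamma>)"
      by (simp add: add_ac flip: powr_add)
    finally show ?thesis
      by simp
  qed
  ultimately show ?thesis
    using G by (simp add: B_def \<gamma>_def)
qed

text \<open>
  The difference \<open>v x - v y\<close> is split at the midpoint \<open>m\<close> of \<open>x\<close> and \<open>y\<close>, which stays in the ball by convexity. Both
  halves contribute the same by symmetry, and the substitution \<open>y = 2 m - x\<close> turns distances \<open>\<bar>x - y\<bar>\<close> into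
  \<open>2 \<bar>x - m\<bar>\<close> at the cost of \<open>2\<^sup>N\<close>.
\<close>

lemma midpoint_doubling:
  fixes v :: "'a::euclidean_space \<Rightarrow> real" and w :: "real \<Rightarrow> ennreal"
  assumes [measurable]: "v \<in> borel_measurable borel" "w \<in> borel_measurable borel" and p: "1 \<le> p"
  shows "(\<integral>\<^sup>+x. (\<integral>\<^sup>+y. ennreal (\<bar>v x - v y\<bar> powr p) * w (norm (x - y)) *
        indicator (ball 0 1) x * indicator (ball 0 1) y \<partial>lborel) \<partial>lborel)
    \<le> ennreal (2 powr (p + real DIM('a))) *
      (\<integral>\<^sup>+x. (\<integral>\<^sup>+y. ennreal (\<bar>v x - v y\<bar> powr p) * w (2 * norm (x - y)) * indicator {..<1} (norm (x - y)) *
        indicator (ball 0 1) x * indicator (ball 0 1) y \<partial>lborel) \<partial>lborel)"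
    (is "?L \<le> _ * ?R")
proof -
  define B where "B = ball (0::'a) 1"
  have [measurable]: "B \<in> sets borel"
    by (simp add: B_def)
  define m where "m x y = (1 / 2) *\<^sub>R (x + y)" for x y :: 'a
  have [measurable]: "(\<lambda>z. m (f z) (g z)) \<in> borel_measurable M"
    if "f \<in> borel_measurable M" "g \<in> borel_measurable M" for f g :: "'z \<Rightarrow> 'a" and M
    unfolding m_def using that by measurable
  have m_commute: "m x y = m y x" for x y
    by (simp add: m_def add.commute)
  define D where "D a b = ennreal (\<bar>a - b\<bar> powr p)" for a b :: real
  have D_commute: "D a b = D b a" for a b
    by (simp add: D_def abs_minus_commute)
  have [measurable]: "(\<lambda>z. D (f z) (g z)) \<in> borel_measurable M"
    if "f \<in> borel_measurable M" "g \<in> borel_measurable M" for f g :: "'z \<Rightarrow> real" and M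
    unfolding D_def using that by measurable
  define T where "T = (\<integral>\<^sup>+x. (\<integral>\<^sup>+y. D (v x) (v (m x y)) * w (norm (x - y)) * indicator B x * indicator B y \<partial>lborel) \<partial>lborel)"
  have D_le: "D (v x) (v y) \<le> ennreal (2 powr (p - 1)) * (D (v x) (v (m x y)) + D (v y) (v (m y x)))" for x y
  proof -
    have "D (v x) (v y) \<le> ennreal (2 powr (p - 1) *
        (\<bar>v x - v (m x y)\<bar> powr p + \<bar>v (m x y) - v y\<bar> powr p))"
      unfolding D_def using abs_add_powr_le[OF p, of "v x - v (m x y)" "v (m x y) - v y"]
      by (intro ennreal_leI) simp
    then show ?thesis
      by (simp add: D_def ennreal_mult' m_commute[of y x] abs_minus_commute[of "v y"])
  qed
  have swap: "(\<integral>\<^sup>+x. (\<integral>\<^sup>+y. D (v y) (v (m y x)) * w (norm (y - x)) * indicator B y * indicator B x \<partial>lborel) \<partial>lborel) = T"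
    unfolding T_def by (rule lborel_pair.Fubini') measurable
  have "?L \<le> (\<integral>\<^sup>+x. (\<integral>\<^sup>+y. ennreal (2 powr (p - 1)) *
      (D (v x) (v (m x y)) * w (norm (x - y)) * indicator B x * indicator B y +
       D (v y) (v (m y x)) * w (norm (y - x)) * indicator B y * indicator B x) \<partial>lborel) \<partial>lborel)"
    unfolding B_def[symmetric] D_def[symmetric]
  proof (intro nn_integral_mono)
    fix x y
    have "D (v x) (v y) * (w (norm (x - y)) * indicator B x * indicator B y)
        \<le> ennreal (2 powr (p - 1)) * (D (v x) (v (m x y)) + D (v y) (v (m y x))) *
          (w (norm (x - y)) * indicator B x * indicator B y)"
      by (rule mult_right_mono[OF D_le]) simp
    then show "D (v x) (v y) * w (norm (x - y)) * indicator B x * indicator B y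
        \<le> ennreal (2 powr (p - 1)) *
          (D (v x) (v (m x y)) * w (norm (x - y)) * indicator B x * indicator B y +
           D (v y) (v (m y x)) * w (norm (y - x)) * indicator B y * indicator B x)"
      by (simp add: norm_minus_commute[of y x] algebra_simps)
  qed
  also have "\<dots> = ennreal (2 powr (p - 1)) *
      ((\<integral>\<^sup>+x. (\<integral>\<^sup>+y. D (v x) (v (m x y)) * w (norm (x - y)) * indicator B x * indicator B y \<partial>lborel) \<partial>lborel) +
       (\<integral>\<^sup>+x. (\<integral>\<^sup>+y. D (v y) (v (m y x)) * w (norm (y - x)) * indicator B y * indicator B x \<partial>lborel) \<partial>lborel))"
    by (simp add: nn_integral_cmult nn_integral_add)
  also have "\<dots> = ennreal (2 powr (p - 1)) * (T + T)"
    unfolding swap T_def ..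
  also have "\<dots> = ennreal (2 powr p) * T"
  proof -
    have "ennreal (2 powr (p - 1)) * (T + T) = ennreal (2 powr (p - 1)) * ennreal 2 * T"
      by (simp add: mult.assoc flip: mult_2)
    also have "ennreal (2 powr (p - 1)) * ennreal 2 = ennreal (2 powr p)"
      by (subst ennreal_mult'[symmetric]) (auto simp: powr_diff)
    finally show ?thesis .
  qed
  finally have first: "?L \<le> ennreal (2 powr p) * T" .
  have inner: "(\<integral>\<^sup>+y. D (v x) (v (m x y)) * w (norm (x - y)) * indicator B x * indicator B y \<partial>lborel)
      \<le> ennreal (2 ^ DIM('a)) * (\<integral>\<^sup>+y. D (v x) (v y) * w (2 * norm (x - y)) *
        indicator {..<1} (norm (x - y)) * indicator B x * indicator B y \<partial>lborel)" for x
  proof -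
    have "(\<integral>\<^sup>+y. D (v x) (v (m x y)) * w (norm (x - y)) * indicator B x * indicator B y \<partial>lborel)
        = ennreal (2 ^ DIM('a)) * (\<integral>\<^sup>+y. D (v x) (v (m x (- x + 2 *\<^sub>R y))) *
          w (norm (x - (- x + 2 *\<^sub>R y))) * indicator B x * indicator B (- x + 2 *\<^sub>R y) \<partial>lborel)"
      by (rule nn_integral_lborel_affine) measurable
    also have "\<dots> \<le> ennreal (2 ^ DIM('a)) * (\<integral>\<^sup>+y. D (v x) (v y) * w (2 * norm (x - y)) *
        indicator {..<1} (norm (x - y)) * indicator B x * indicator B y \<partial>lborel)"
    proof (intro mult_left_mono nn_integral_mono)
      fix y
      have mid: "m x (- x + 2 *\<^sub>R y) = y"
        by (simp add: m_def)
      have "x - (- x + 2 *\<^sub>R y) = 2 *\<^sub>R (x - y)"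
        by (simp add: algebra_simps scaleR_2)
      then have dist: "norm (x - (- x + 2 *\<^sub>R y)) = 2 * norm (x - y)"
        by simp
      have "norm (x - y) < 1 \<and> y \<in> B" if "x \<in> B" "- x + 2 *\<^sub>R y \<in> B"
      proof
        show "norm (x - y) < 1"
          using norm_triangle_ineq4[of x "- x + 2 *\<^sub>R y"] dist that by (simp add: B_def)
        have "2 *\<^sub>R y = x + (- x + 2 *\<^sub>R y)"
          by simp
        then have "2 * norm y \<le> norm x + norm (- x + 2 *\<^sub>R y)"
          by (metis norm_scaleR norm_triangle_ineq abs_numeral)
        then show "y \<in> B"
          using that by (simp add: B_def)
      qed
      then show "D (v x) (v (m x (- x + 2 *\<^sub>R y))) * w (norm (x - (- x + 2 *\<^sub>R y))) *
          indicator B x * indicator B (- x + 2 *\<^sub>R y)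
        \<le> D (v x) (v y) * w (2 * norm (x - y)) *
          indicator {..<1} (norm (x - y)) * indicator B x * indicator B y"
        unfolding mid dist by (auto simp: indicator_def)
    qed simp
    finally show ?thesis .
  qed
  have "T \<le> (\<integral>\<^sup>+x. ennreal (2 ^ DIM('a)) * (\<integral>\<^sup>+y. D (v x) (v y) * w (2 * norm (x - y)) *
        indicator {..<1} (norm (x - y)) * indicator B x * indicator B y \<partial>lborel) \<partial>lborel)"
    unfolding T_def by (intro nn_integral_mono inner)
  also have "\<dots> = ennreal (2 ^ DIM('a)) * ?R"
    unfolding B_def[symmetric] D_def[symmetric] by (rule nn_integral_cmult) measurable
  finally have "?L \<le> ennreal (2 powr p) * (ennreal (2 ^ DIM('a)) * ?R)"
    using first by (meson mult_left_mono order_trans zero_le)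
  also have "\<dots> = ennreal (2 powr (p + real DIM('a))) * ?R"
    by (simp add: powr_add powr_realpow ennreal_mult' mult.assoc)
  finally show ?thesis .
qed

text \<open>
  The arithmetic that turns the doubling inequality into the Poincare inequality. Here \<open>rj\<close> and \<open>rD\<close> stand
  for the double integrals of \<open>\<bar>v x - v y\<bar>\<^sup>p\<close> against \<open>\<bar>x - y\<bar> powr (- \<gamma>)\<close> and against \<open>1\<close>, \<open>rji\<close> and \<open>ri\<close> for their
  parts with \<open>\<bar>x - y\<bar> < 1\<close>, \<open>ro\<close> for the remaining part of \<open>rD\<close>, and \<open>rw\<close>, \<open>rw'\<close> for the two sides of the
  doubling inequality with weight \<open>t powr (- \<gamma>) - c\<close>. They combine to \<open>\<theta> rj + c rD \<le> rj\<close>, and \<open>1 - \<theta> \<le> (1 - s) p\<close>.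
\<close>

lemma doubling_absorption:
  fixes rj rw rD ri ro rji rw' c p s d \<gamma> \<theta> :: real
  assumes p: "1 \<le> p" and s: "0 < s" "s < 1" and \<gamma>: "1 \<le> \<gamma>" and \<gamma>_def: "\<gamma> = d + s * p"
    and c: "0 < c" "2 powr - \<gamma> = 2 * c" and c_def: "c = 2 powr - (\<gamma> + 1)"
    and \<theta>_def: "\<theta> = 2 powr - ((1 - s) * p)" and \<theta>: "0 < \<theta>" "\<theta> \<le> 1"
    and nn: "0 \<le> ri" "0 \<le> rD" "0 \<le> rj"
    and r1: "rj = rw + c * rD" and r2: "rw' + c * ri = 2 * c * rji" and r3: "rD = ri + ro"
    and r4: "rji + 2 * c * ro \<le> rj" and r5: "rw \<le> 2 powr (p + d) * rw'"
  shows "rD \<le> (1 - s) * p * 2 powr (\<gamma> + 1) * rj"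
proof -
  have A: "\<theta> * 2 powr (p + d) * (2 * c) = 1"
  proof -
    have "\<theta> * 2 powr (p + d) * (2 * c) = 2 powr (- ((1 - s) * p) + (p + d) + - \<gamma>)"
      unfolding \<theta>_def c(2)[symmetric] powr_add ..
    also have "- ((1 - s) * p) + (p + d) + - \<gamma> = 0"
      by (simp add: \<gamma>_def algebra_simps)
    finally show ?thesis by simp
  qed
  have "\<theta> * rw \<le> \<theta> * (2 powr (p + d) * rw')"
    by (rule mult_left_mono[OF r5]) (use \<theta>(1) in simp)
  then have "2 * c * (\<theta> * rw) \<le> 2 * c * (\<theta> * (2 powr (p + d) * rw'))"
    by (rule mult_left_mono) (use c(1) in simp)
  also have "\<dots> = (\<theta> * 2 powr (p + d) * (2 * c)) * rw'"
    by (simp add: mult_ac)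
  also have "\<dots> = 2 * c * rji - c * ri"
    unfolding A using r2 by simp
  finally have "c * (2 * (\<theta> * rw)) \<le> c * (2 * rji - ri)"
    by (simp add: algebra_simps)
  then have r6: "\<theta> * rw \<le> rji - ri / 2"
    using c(1) by simp
  have "2 * c \<le> 1 / 2"
  proof -
    have "2 powr - \<gamma> \<le> 2 powr - (1::real)"
      using \<gamma> by (intro powr_mono) auto
    also have "2 powr - (1::real) = 1 / 2"
      by (simp add: powr_minus)
    finally show ?thesis
      unfolding c(2) .
  qed
  then have "2 * c * ri \<le> 1 / 2 * ri"
    using nn(1) by (rule mult_right_mono)
  moreover have "\<theta> * rj - \<theta> * (c * rD) = \<theta> * rw"
    unfolding r1 by (simp add: distrib_left)
  moreover have "2 * c * rD = 2 * c * ri + 2 * c * ro"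
    unfolding r3 by (simp add: distrib_left)
  ultimately have "\<theta> * rj - \<theta> * (c * rD) \<le> rj - 2 * c * rD"
    using r4 r6 by linarith
  moreover have "\<theta> * (c * rD) \<le> 1 * (c * rD)"
    using \<theta> c(1) nn(2) by (intro mult_right_mono) auto
  ultimately have "c * rD \<le> rj - \<theta> * rj"
    by linarith
  also have "\<dots> = (1 - \<theta>) * rj"
    by (simp add: left_diff_distrib)
  also have "\<dots> \<le> (1 - s) * p * rj"
    by (rule mult_right_mono) (use one_minus_two_powr_le[of "(1 - s) * p"] s p nn(3) in \<open>auto simp: \<theta>_def\<close>)
  finally have "rD \<le> (1 - s) * p * rj / c"
    using c(1) by (simp add: pos_le_divide_eq mult.commute)
  also have "\<dots> = (1 - s) * p * (1 / c) * rj"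
    by simp
  also have "1 / c = 2 powr (\<gamma> + 1)"
    by (simp add: c_def powr_minus_divide powr_diff powr_add)
  finally show ?thesis .
qed
text \<open>
  For the weight \<open>t powr (- \<gamma>)\<close> alone, doubling gives \<open>\<theta> J \<le> J\<^sub>1\<close> with \<open>\<theta> = 2 powr (- (1 - s) p)\<close>, where \<open>J\<close> is the
  seminorm on the ball and \<open>J\<^sub>1\<close> its part from distances below \<open>1\<close>. Hence distances above \<open>1\<close> carry at most
  the share \<open>1 - \<theta>\<close>, of order \<open>1 - s\<close>. Subtracting a small constant \<open>c\<close> from the weight before doubling makes
  the same single step control all distances: the constant weight gains the factor
  \<open>2 powr (N + s p)\<close> more than the singular one, and the surplus is a multiple of the oscillation.
\<close>

lemma oscillation_le_near:
  fixes v :: "'a::euclidean_space \<Rightarrow> real"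
  assumes [measurable]: "v \<in> borel_measurable borel" and p: "1 \<le> p" and s: "0 < s" "s < 1"
  shows "oscillation p v
    \<le> ennreal ((1 - s) * p * 2 powr (real DIM('a) + s * p + 1)) * gagliardo s p (ball 0 1) (ball 0 1) v"
proof -
  define \<gamma> where "\<gamma> = real DIM('a) + s * p"
  have "0 < s * p"
    using s p by simp
  moreover have "1 \<le> real DIM('a)"
    by (simp add: Suc_le_eq)
  ultimately have \<gamma>: "1 \<le> \<gamma>"
    unfolding \<gamma>_def by linarith
  \<comment> \<open>Half the minimum of \<open>t powr (- \<gamma>)\<close> on \<open>(0, 2)\<close>, so that the reduced weight stays positive and
    the distances above \<open>1\<close>, where the weight is at least \<open>2 c\<close>, still pay for the subtraction.\<close>
  define c where "c = 2 powr - (\<gamma> + 1)"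
  have c: "0 < c" "2 powr - \<gamma> = 2 * c"
    by (simp_all add: c_def powr_diff powr_minus)
  define \<theta> where "\<theta> = 2 powr - ((1 - s) * p)"
  have \<theta>: "0 < \<theta>" "\<theta> \<le> 1"
    using s p powr_mono[of "- ((1 - s) * p)" 0 2] by (auto simp: \<theta>_def)
  define w where "w t = ennreal (t powr - \<gamma> - c)" for t
  have [measurable]: "w \<in> borel_measurable borel"
    unfolding w_def by measurable
  have [measurable]: "ball (0::'a) 1 \<in> sets borel"
    by simp
  define E where "E k = (\<integral>\<^sup>+x. (\<integral>\<^sup>+y. ennreal (\<bar>v x - v y\<bar> powr p) * k (norm (x - y)) *
     indicator (ball 0 1) x * indicator (ball 0 1) y \<partial>lborel) \<partial>lborel)" for k :: "real \<Rightarrow> ennreal"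
  have E_add: "E (\<lambda>t. k t + l t) = E k + E l"
    if [measurable]: "k \<in> borel_measurable borel" "l \<in> borel_measurable borel" for k l
    unfolding E_def by (simp add: distrib_left distrib_right nn_integral_add)
  have E_cmult: "E (\<lambda>t. a * k t) = a * E k"
    if [measurable]: "k \<in> borel_measurable borel" for k a
  proof -
    have "E (\<lambda>t. a * k t) = (\<integral>\<^sup>+x. (\<integral>\<^sup>+y. a * (ennreal (\<bar>v x - v y\<bar> powr p) * k (norm (x - y)) *
       indicator (ball 0 1) x * indicator (ball 0 1) y) \<partial>lborel) \<partial>lborel)"
      unfolding E_def by (simp add: mult_ac)
    then show ?thesis
      unfolding E_def by (simp add: nn_integral_cmult)
  qed
  \<comment> \<open>Only distances in \<open>(0, 2)\<close> occur: on the diagonal the difference of the values vanishes.\<close>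
  have E_mono: "E k \<le> E l" if "\<And>t. 0 < t \<Longrightarrow> t < 2 \<Longrightarrow> k t \<le> l t" for k l
    unfolding E_def
  proof (intro nn_integral_mono)
    fix x y :: 'a
    have "k (norm (x - y)) \<le> l (norm (x - y))" if "norm x < 1" "norm y < 1" "x \<noteq> y"
      using norm_triangle_ineq4[of x y] that \<open>\<And>t. 0 < t \<Longrightarrow> t < 2 \<Longrightarrow> k t \<le> l t\<close>[of "norm (x - y)"] by simp
    then show "ennreal (\<bar>v x - v y\<bar> powr p) * k (norm (x - y)) * indicator (ball 0 1) x * indicator (ball 0 1) y
        \<le> ennreal (\<bar>v x - v y\<bar> powr p) * l (norm (x - y)) * indicator (ball 0 1) x * indicator (ball 0 1) y"
      by (cases "x = y") (auto simp: indicator_def intro!: mult_left_mono)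
  qed
  define j where "j t = ennreal (t powr - \<gamma>)" for t
  define i :: "real \<Rightarrow> ennreal" where "i = indicator {..<1}"
  define o' :: "real \<Rightarrow> ennreal" where "o' = indicator {1..}"
  have [measurable]: "j \<in> borel_measurable borel" "i \<in> borel_measurable borel" "o' \<in> borel_measurable borel"
    unfolding j_def i_def o'_def by measurable
  have osc: "oscillation p v = E (\<lambda>t. 1)"
    by (simp add: oscillation_def E_def)
  have gag: "gagliardo s p (ball 0 1) (ball 0 1) v = E j"
    by (subst gagliardo_iterated)
      (auto simp: E_def j_def gagliardo_kernel_def \<gamma>_def[symmetric] powr_minus_divide
        simp flip: ennreal_mult' intro!: nn_integral_cong)
  have large: "c \<le> t powr - \<gamma>" "2 * c \<le> t powr - \<gamma>" if "0 < t" "t < 2" for t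
  proof -
    have "2 powr - \<gamma> \<le> t powr - \<gamma>"
      using that \<gamma> by (intro powr_mono2') auto
    then show "2 * c \<le> t powr - \<gamma>" "c \<le> t powr - \<gamma>"
      using c by auto
  qed
  have split: "w t + ennreal c = j t" if "0 < t" "t < 2" for t
    using large(1)[OF that] c(1) by (simp add: w_def j_def flip: ennreal_plus)
  have J: "E j = E w + ennreal c * E (\<lambda>t. 1)"
  proof -
    have "E j = E (\<lambda>t. w t + ennreal c * 1)"
      by (intro antisym E_mono) (auto simp: split)
    then show ?thesis
      by (simp only: E_add E_cmult borel_measurable_const measurable \<open>w \<in> borel_measurable borel\<close>
          borel_measurable_times)
  qed
  have J1: "E (\<lambda>t. w (2 * t) * i t) + ennreal c * E i = ennreal (2 * c) * E (\<lambda>t. j t * i t)"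
  proof -
    have "E (\<lambda>t. w (2 * t) * i t) + ennreal c * E i = E (\<lambda>t. w (2 * t) * i t + ennreal c * i t)"
      by (subst E_add) (auto simp: E_cmult)
    also have "\<dots> = E (\<lambda>t. ennreal (2 * c) * (j t * i t))"
    proof (intro antisym E_mono)
      fix t :: real assume t: "0 < t" "t < 2"
      have "w (2 * t) * i t + ennreal c * i t = ennreal (2 * c) * (j t * i t)"
      proof (cases "t < 1")
        case True
        then have "w (2 * t) + ennreal c = j (2 * t)"
          using t by (intro split) auto
        also have "\<dots> = ennreal (2 * c) * j t"
          using t c(1) by (simp add: j_def powr_mult c(2) flip: ennreal_mult')
        finally show ?thesis
          using True by (simp add: i_def)
      qed (simp add: i_def)
      then show "w (2 * t) * i t + ennreal c * i t \<le> ennreal (2 * c) * (j t * i t)"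
        "ennreal (2 * c) * (j t * i t) \<le> w (2 * t) * i t + ennreal c * i t"
        by simp_all
    qed
    finally show ?thesis
      by (subst (asm) E_cmult) auto
  qed
  have D_split: "E (\<lambda>t. 1) = E i + E o'"
    by (subst E_add[symmetric]) (auto simp: i_def o'_def indicator_def intro!: antisym E_mono)
  have J_split: "E (\<lambda>t. j t * i t) + ennreal (2 * c) * E o' \<le> E j"
  proof -
    have "E (\<lambda>t. j t * i t) + ennreal (2 * c) * E o' = E (\<lambda>t. j t * i t + ennreal (2 * c) * o' t)"
      by (subst E_add) (auto simp: E_cmult)
    also have "\<dots> \<le> E j"
      by (rule E_mono) (auto simp: i_def o'_def indicator_def j_def intro!: ennreal_leI large)
    finally show ?thesis .
  qed
  have doubling: "E w \<le> ennreal (2 powr (p + real DIM('a))) * E (\<lambda>t. w (2 * t) * i t)"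
    using midpoint_doubling[of v w p] p
    unfolding E_def i_def by (simp add: mult_ac)
  show ?thesis
  proof (cases "E j = \<infinity>")
    case True
    have "0 < (1 - s) * p * 2 powr (real DIM('a) + s * p + 1)"
      using s p by simp
    then show ?thesis
      using True s p unfolding gag by (simp add: ennreal_mult_top)
  next
    case False
    have fin: "E j < \<infinity>" "E w < \<infinity>" "E (\<lambda>t. 1) < \<infinity>" "E i < \<infinity>" "E o' < \<infinity>"
      "E (\<lambda>t. j t * i t) < \<infinity>" "E (\<lambda>t. w (2 * t) * i t) < \<infinity>"
    proof -
      show "E j < \<infinity>" using False by (simp add: top.not_eq_extremum)
      then show "E w < \<infinity>" "E (\<lambda>t. 1) < \<infinity>"
        using c(1) unfolding J by (auto simp: ennreal_mult_less_top)
      then show "E i < \<infinity>" "E o' < \<infinity>"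
        unfolding D_split by auto
      show ji: "E (\<lambda>t. j t * i t) < \<infinity>"
        using J_split \<open>E j < \<infinity>\<close> by (meson add_increasing2 order.strict_trans1 order_refl zero_le)
      have "ennreal (2 * c) * E (\<lambda>t. j t * i t) < \<infinity>"
        using ji by (simp add: ennreal_mult_less_top)
      then show "E (\<lambda>t. w (2 * t) * i t) < \<infinity>"
        unfolding J1[symmetric] by simp
    qed
    have real: "\<exists>a\<ge>0. e = ennreal a" if "e < \<infinity>" for e :: ennreal
      using that by (cases e) auto
    obtain rj where e_rj: "E j = ennreal rj" "0 \<le> rj"
      using real[OF fin(1)] by blast
    obtain rw where e_rw: "E w = ennreal rw" "0 \<le> rw"
      using real[OF fin(2)] by blast
    obtain rD where e_rD: "E (\<lambda>t. 1) = ennreal rD" "0 \<le> rD"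
      using real[OF fin(3)] by blast
    obtain ri where e_ri: "E i = ennreal ri" "0 \<le> ri"
      using real[OF fin(4)] by blast
    obtain ro where e_ro: "E o' = ennreal ro" "0 \<le> ro"
      using real[OF fin(5)] by blast
    obtain rji where e_rji: "E (\<lambda>t. j t * i t) = ennreal rji" "0 \<le> rji"
      using real[OF fin(6)] by blast
    obtain rw' where e_rw1: "E (\<lambda>t. w (2 * t) * i t) = ennreal rw'" "0 \<le> rw'"
      using real[OF fin(7)] by blast
    note r = e_rj e_rw e_rD e_ri e_ro e_rji e_rw1
    have r1: "rj = rw + c * rD"
    proof -
      have "ennreal rj = ennreal rw + ennreal c * ennreal rD"
        using J unfolding e_rj(1) e_rw(1) e_rD(1) .
      also have "\<dots> = ennreal (rw + c * rD)"
        using c(1) e_rw(2) e_rD(2) by (simp add: ennreal_mult')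
      finally show ?thesis
        using c(1) e_rw(2) e_rD(2) e_rj(2) by (subst (asm) ennreal_inj) auto
    qed
    have r2: "rw' + c * ri = 2 * c * rji"
      using J1 c(1) r by (simp add: ennreal_mult'[symmetric] ennreal_plus[symmetric] del: ennreal_plus)
    have r3: "rD = ri + ro"
      using D_split r by (simp add: ennreal_plus[symmetric] del: ennreal_plus)
    have r4: "rji + 2 * c * ro \<le> rj"
      using J_split c(1) r by (simp add: ennreal_mult'[symmetric] ennreal_plus[symmetric] del: ennreal_plus)
    have r5: "rw \<le> 2 powr (p + real DIM('a)) * rw'"
      using doubling r by (simp add: ennreal_mult'[symmetric])
    have "rD \<le> (1 - s) * p * 2 powr (\<gamma> + 1) * rj"
      by (rule doubling_absorption[OF p s \<gamma> \<gamma>_def c c_def \<theta>_def \<theta> e_ri(2) e_rD(2) e_rj(2) r1 r2 r3 r4 r5])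
    then have "ennreal rD \<le> ennreal ((1 - s) * p * 2 powr (\<gamma> + 1)) * ennreal rj"
      using e_rj(2) by (subst ennreal_mult''[symmetric]) (auto intro: ennreal_leI)
    then show ?thesis
      unfolding osc gag e_rj(1) e_rD(1) \<gamma>_def .
  qed
qed

text \<open>
  The two Poincare inequalities carry the factors \<open>s\<close> and \<open>1 - s\<close>, and \<open>min s (1 - s) \<le> 2 s (1 - s)\<close>.
\<close>

lemma oscillation_le:
  fixes v :: "'a::euclidean_space \<Rightarrow> real"
  assumes v: "v \<in> borel_measurable borel" and p: "1 \<le> p" and s: "0 < s" "s < 1"
  shows "oscillation p v
    \<le> ennreal (p * 2 powr (2 * real DIM('a) + 3 * p + 1) * (s * (1 - s))) * gagliardo s p (ball 0 1) UNIV v"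
proof -
  define A where "A = p * 2 powr (2 * real DIM('a) + 3 * p)"
  define G where "G = gagliardo s p (ball 0 1) UNIV v"
  have A: "0 < A" using p by (simp add: A_def)
  have sp: "s * p \<le> p"
    using s p by simp
  have far: "oscillation p v \<le> ennreal (s * A) * G"
  proof -
    have "p + 2 * (real DIM('a) + s * p) \<le> 2 * real DIM('a) + 3 * p"
      using sp by simp
    then have le: "s * p * 2 powr (p + 2 * (real DIM('a) + s * p)) \<le> s * A"
      unfolding A_def mult.assoc using s p by (intro mult_left_mono powr_mono) auto
    show ?thesis
      unfolding G_def
      by (rule order_trans[OF oscillation_le_far[OF v p s(1)]], rule mult_right_mono, rule ennreal_leI[OF le])
        simp
  qed
  have near: "oscillation p v \<le> ennreal ((1 - s) * A) * G"
  proof -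
    have "1 \<le> real DIM('a)"
      by (simp add: Suc_le_eq)
    then have "real DIM('a) + s * p + 1 \<le> 2 * real DIM('a) + 3 * p"
      using sp p by linarith
    then have le: "(1 - s) * p * 2 powr (real DIM('a) + s * p + 1) \<le> (1 - s) * A"
      unfolding A_def mult.assoc using s p by (intro mult_left_mono powr_mono) auto
    \<comment> \<open>This estimate uses only pairs inside the ball, so the seminorm may be enlarged.\<close>
    show ?thesis
      unfolding G_def
      by (rule order_trans[OF oscillation_le_near[OF v p s]], rule mult_mono, rule ennreal_leI[OF le])
        (auto intro: gagliardo_mono)
  qed
  have "oscillation p v \<le> ennreal (A * 2 * (s * (1 - s))) * G"
  proof (cases "s \<le> 1 / 2")
    case True
    have "s * A * 1 \<le> s * A * (2 * (1 - s))"
      using True s A by (intro mult_left_mono) auto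
    then show ?thesis
      by (intro order_trans[OF far] mult_right_mono ennreal_leI) (auto simp: mult_ac)
  next
    case False
    have "(1 - s) * A * 1 \<le> (1 - s) * A * (2 * s)"
      using False s A by (intro mult_left_mono) auto
    then show ?thesis
      by (intro order_trans[OF near] mult_right_mono ennreal_leI) (auto simp: mult_ac)
  qed
  then show ?thesis
    by (simp add: A_def G_def powr_add mult_ac)
qed

section \<open>Norms and seminorms under dilation\<close>

lemma ball_borel [measurable]: "ball (x::'a::euclidean_space) r \<in> sets borel"
  by simp

lemma ennpowr_mono: "x \<le> y \<Longrightarrow> 0 \<le> a \<Longrightarrow> ennpowr x a \<le> ennpowr y a"
  by (auto simp: ennpowr_def top_unique less_top enn2real_mono intro!: ennreal_leI powr_mono2)

lemma ennpowr_cmult: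
  assumes "0 < c"
  shows "ennpowr (ennreal c * x) a = ennreal (c powr a) * ennpowr x a"
proof (cases x)
  case (real r)
  then show ?thesis
    using assms by (simp add: ennpowr_def powr_mult flip: ennreal_mult')
next
  case top
  then show ?thesis
    using assms by (simp add: ennpowr_def ennreal_mult_top)
qed

lemma ennpowr_eq_0_iff: "ennpowr x a = 0 \<longleftrightarrow> x = 0"
  by (cases x) (auto simp: ennpowr_def)

lemma ennpowr_less_top: "x < top \<Longrightarrow> ennpowr x a < top"
  by (auto simp: ennpowr_def)

text \<open>
  Reduces the essential supremum over a restricted measure space to a statement about almost all points
  of the whole space, in which form the sup norm is handled below.
\<close>

lemma Lq_norm_infinity_le_iff:
  fixes f :: "'a::euclidean_space \<Rightarrow> real"
  assumes [measurable]: "f \<in> borel_measurable borel" "E \<in> sets borel"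
  shows "Lq_norm \<infinity> E f \<le> K \<longleftrightarrow> (AE x in lborel. x \<in> E \<longrightarrow> ennreal \<bar>f x\<bar> \<le> K)"
proof
  have E: "E \<inter> space lborel \<in> sets lborel"
    by simp
  assume *: "Lq_norm \<infinity> E f \<le> K"
  have "AE x in restrict_space lborel E. ennreal \<bar>f x\<bar> \<le> Lq_norm \<infinity> E f"
    using esssup_AE[of "\<lambda>x. ennreal \<bar>f x\<bar>" "restrict_space lborel E"] by (simp add: Lq_norm_def)
  then have "AE x in restrict_space lborel E. ennreal \<bar>f x\<bar> \<le> K"
    by eventually_elim (use * in \<open>auto intro: order_trans\<close>)
  then show "AE x in lborel. x \<in> E \<longrightarrow> ennreal \<bar>f x\<bar> \<le> K"
    by (simp add: AE_restrict_space_iff[OF E])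
next
  have E: "E \<inter> space lborel \<in> sets lborel"
    by simp
  assume "AE x in lborel. x \<in> E \<longrightarrow> ennreal \<bar>f x\<bar> \<le> K"
  then have "AE x in restrict_space lborel E. ennreal \<bar>f x\<bar> \<le> K"
    by (simp add: AE_restrict_space_iff[OF E])
  then show "Lq_norm \<infinity> E f \<le> K"
    unfolding Lq_norm_def by (auto intro!: esssup_I measurable_restrict_space1)
qed

lemma Lq_norm_mono:
  fixes f g :: "'a::euclidean_space \<Rightarrow> real"
  assumes [measurable]: "f \<in> borel_measurable borel" "g \<in> borel_measurable borel"
      "E \<in> sets borel" "E' \<in> sets borel"
    and "E \<subseteq> E'" and le: "\<And>x. x \<in> E \<Longrightarrow> \<bar>f x\<bar> \<le> \<bar>g x\<bar>"
  shows "Lq_norm q E f \<le> Lq_norm q E' g"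
proof (cases "q = \<infinity>")
  case True
  have "AE x in lborel. x \<in> E' \<longrightarrow> ennreal \<bar>g x\<bar> \<le> Lq_norm \<infinity> E' g"
    by (subst Lq_norm_infinity_le_iff[symmetric]) auto
  then have "AE x in lborel. x \<in> E \<longrightarrow> ennreal \<bar>f x\<bar> \<le> Lq_norm \<infinity> E' g"
    by eventually_elim (use assms(5) order_trans[OF ennreal_leI[OF le]] in blast)
  then show ?thesis
    unfolding True by (subst Lq_norm_infinity_le_iff) auto
next
  case False
  have "(\<integral>\<^sup>+x\<in>E. ennreal (\<bar>f x\<bar> powr enn2real q) \<partial>lborel) \<le> (\<integral>\<^sup>+x\<in>E'. ennreal (\<bar>g x\<bar> powr enn2real q) \<partial>lborel)"
    using assms(5) le by (intro nn_integral_mono) (auto simp: indicator_def intro!: ennreal_leI powr_mono2)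
  then show ?thesis
    using False by (simp add: Lq_norm_def ennpowr_mono)
qed

lemma Lq_norm_cmult:
  fixes f :: "'a::euclidean_space \<Rightarrow> real"
  assumes f [measurable]: "f \<in> borel_measurable borel" and E [measurable]: "E \<in> sets borel"
    and q: "1 \<le> q" and "0 < c"
  shows "Lq_norm q E (\<lambda>x. c * f x) = ennreal c * Lq_norm q E f"
proof (cases "q = \<infinity>")
  case True
  have le: "Lq_norm \<infinity> E (\<lambda>x. d * g x) \<le> ennreal d * Lq_norm \<infinity> E g"
    if [measurable]: "g \<in> borel_measurable borel" and "0 < d" for g :: "'a \<Rightarrow> real" and d
  proof -
    have "AE x in lborel. x \<in> E \<longrightarrow> ennreal \<bar>g x\<bar> \<le> Lq_norm \<infinity> E g"
      by (subst Lq_norm_infinity_le_iff[symmetric]) auto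
    then have "AE x in lborel. x \<in> E \<longrightarrow> ennreal \<bar>d * g x\<bar> \<le> ennreal d * Lq_norm \<infinity> E g"
      by eventually_elim (use \<open>0 < d\<close> in \<open>auto simp: abs_mult ennreal_mult' intro: mult_left_mono\<close>)
    then show ?thesis
      by (subst Lq_norm_infinity_le_iff) auto
  qed
  have "ennreal c * Lq_norm \<infinity> E f = ennreal c * Lq_norm \<infinity> E (\<lambda>x. (1 / c) * (c * f x))"
    using \<open>0 < c\<close> by simp
  also have "\<dots> \<le> ennreal c * (ennreal (1 / c) * Lq_norm \<infinity> E (\<lambda>x. c * f x))"
    by (rule mult_left_mono[OF le]) (use \<open>0 < c\<close> in auto)
  also have "\<dots> = Lq_norm \<infinity> E (\<lambda>x. c * f x)"
    using \<open>0 < c\<close> by (simp add: mult.assoc[symmetric] flip: ennreal_mult')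
  finally show ?thesis
    unfolding True using le[OF f \<open>0 < c\<close>] by (rule antisym[rotated])
next
  case False
  define r where "r = enn2real q"
  have r: "0 < r"
    using q False unfolding r_def by (cases q) auto
  have "(\<integral>\<^sup>+x\<in>E. ennreal (\<bar>c * f x\<bar> powr r) \<partial>lborel) = (\<integral>\<^sup>+x. ennreal (c powr r) * (ennreal (\<bar>f x\<bar> powr r) * indicator E x) \<partial>lborel)"
    using \<open>0 < c\<close> by (intro nn_integral_cong) (auto simp: abs_mult powr_mult ennreal_mult' mult.assoc)
  also have "\<dots> = ennreal (c powr r) * (\<integral>\<^sup>+x\<in>E. ennreal (\<bar>f x\<bar> powr r) \<partial>lborel)"
    by (rule nn_integral_cmult) measurable
  finally show ?thesis
    using False r \<open>0 < c\<close> by (simp add: Lq_norm_def r_def[symmetric] ennpowr_cmult powr_powr)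
qed

lemma Lq_norm_eq_0_iff:
  fixes f :: "'a::euclidean_space \<Rightarrow> real"
  assumes [measurable]: "f \<in> borel_measurable borel" "E \<in> sets borel" 
  shows "Lq_norm q E f = 0 \<longleftrightarrow> (AE x in lborel. x \<in> E \<longrightarrow> f x = 0)"
proof (cases "q = \<infinity>")
  case True
  have "Lq_norm q E f = 0 \<longleftrightarrow> Lq_norm \<infinity> E f \<le> 0"
    by (simp add: True)
  also have "\<dots> \<longleftrightarrow> (AE x in lborel. x \<in> E \<longrightarrow> f x = 0)"
    by (subst Lq_norm_infinity_le_iff) auto
  finally show ?thesis .
next
  case False
  then have "Lq_norm q E f = 0 \<longleftrightarrow> (\<integral>\<^sup>+x\<in>E. ennreal (\<bar>f x\<bar> powr enn2real q) \<partial>lborel) = 0"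
    by (simp add: Lq_norm_def ennpowr_eq_0_iff)
  also have "\<dots> \<longleftrightarrow> (AE x in lborel. x \<in> E \<longrightarrow> f x = 0)"
    by (subst nn_integral_0_iff_AE) (auto simp: indicator_def)
  finally show ?thesis .
qed

lemma Lq_norm_bounded_less_top:
  fixes f :: "'a::euclidean_space \<Rightarrow> real"
  assumes [measurable]: "f \<in> borel_measurable borel" "E \<in> sets borel"
    and E: "emeasure lborel E < \<infinity>" and K: "\<And>x. x \<in> E \<Longrightarrow> \<bar>f x\<bar> \<le> K"
  shows "Lq_norm q E f < \<infinity>"
proof (cases "q = \<infinity>")
  case True
  have "Lq_norm \<infinity> E f \<le> ennreal K"
    using K by (subst Lq_norm_infinity_le_iff) (auto intro: ennreal_leI)
  then show ?thesis
    unfolding True by (rule order.strict_trans1) simp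
next
  case False
  have "(\<integral>\<^sup>+x\<in>E. ennreal (\<bar>f x\<bar> powr enn2real q) \<partial>lborel) \<le> (\<integral>\<^sup>+x\<in>E. ennreal (K powr enn2real q) \<partial>lborel)"
    using K by (intro nn_integral_mono) (auto simp: indicator_def intro!: ennreal_leI powr_mono2)
  also have "\<dots> = ennreal (K powr enn2real q) * emeasure lborel E"
    by (rule nn_integral_cmult_indicator) simp
  also have "\<dots> < \<infinity>"
    using E by (simp add: ennreal_mult_less_top)
  finally show ?thesis
    using False by (simp add: Lq_norm_def ennpowr_less_top)
qed

lemma AE_lborel_affineD:
  fixes P :: "'a::euclidean_space \<Rightarrow> bool"
  assumes [measurable]: "Measurable.pred borel P" and "0 < c" and "AE x in lborel. P (t + c *\<^sub>R x)"
  shows "AE x in lborel. P x"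
proof -
  have "(\<integral>\<^sup>+x. indicator {x. \<not> P x} (t + c *\<^sub>R x) \<partial>lborel) = 0"
    using assms(3) by (subst nn_integral_0_iff_AE) (auto simp: indicator_def)
  then have "(\<integral>\<^sup>+x. indicator {x. \<not> P x} x \<partial>lborel) = 0"
    using nn_integral_lborel_affine[of "indicator {x. \<not> P x}" c t] assms(2) by simp
  then show ?thesis
    by (subst (asm) nn_integral_0_iff_AE) (auto simp: indicator_def)
qed

lemma affine_in_ball_iff:
  fixes x :: "'a::euclidean_space"
  assumes "0 < R"
  shows "x0 + R *\<^sub>R x \<in> ball x0 (R * \<rho>) \<longleftrightarrow> x \<in> ball 0 \<rho>"
  using assms by (simp add: dist_norm)

lemma Lq_norm_rescale:
  fixes f :: "'a::euclidean_space \<Rightarrow> real"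
  assumes [measurable]: "f \<in> borel_measurable borel" and "0 < R"
  shows "Lq_norm q (ball x0 (R * \<rho>)) f
    \<le> ennreal (R powr exp_ratio (real DIM('a)) q) * Lq_norm q (ball 0 \<rho>) (\<lambda>x. f (x0 + R *\<^sub>R x))"
    (is "?L \<le> _ * ?N")
proof (cases "q = \<infinity>")
  case True
  have "AE x in lborel. x \<in> ball 0 \<rho> \<longrightarrow> ennreal \<bar>f (x0 + R *\<^sub>R x)\<bar> \<le> ?N"
    unfolding True by (subst Lq_norm_infinity_le_iff[symmetric]) auto
  then have "AE x in lborel. x0 + R *\<^sub>R x \<in> ball x0 (R * \<rho>) \<longrightarrow> ennreal \<bar>f (x0 + R *\<^sub>R x)\<bar> \<le> ?N"
    unfolding affine_in_ball_iff[OF assms(2)] .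
  then have "AE x in lborel. x \<in> ball x0 (R * \<rho>) \<longrightarrow> ennreal \<bar>f x\<bar> \<le> ?N"
    by (rule AE_lborel_affineD[rotated 2]) (measurable, use assms(2) in simp)
  then have "?L \<le> ?N"
    unfolding True by (subst Lq_norm_infinity_le_iff) auto
  then show ?thesis
    using assms(2) by (simp add: True exp_ratio_def)
next
  case False
  define r where "r = enn2real q"
  have "(\<integral>\<^sup>+x\<in>ball x0 (R * \<rho>). ennreal (\<bar>f x\<bar> powr r) \<partial>lborel)
      = ennreal (R ^ DIM('a)) * (\<integral>\<^sup>+x. ennreal (\<bar>f (x0 + R *\<^sub>R x)\<bar> powr r) * indicator (ball x0 (R * \<rho>)) (x0 + R *\<^sub>R x) \<partial>lborel)"
    by (rule nn_integral_lborel_affine) (measurable, use assms(2) in simp)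
  also have "(\<integral>\<^sup>+x. ennreal (\<bar>f (x0 + R *\<^sub>R x)\<bar> powr r) * indicator (ball x0 (R * \<rho>)) (x0 + R *\<^sub>R x) \<partial>lborel)
      = (\<integral>\<^sup>+x\<in>ball 0 \<rho>. ennreal (\<bar>f (x0 + R *\<^sub>R x)\<bar> powr r) \<partial>lborel)"
    unfolding indicator_def affine_in_ball_iff[OF assms(2)] ..
  finally have "?L = ennreal ((R ^ DIM('a)) powr (1 / r)) * ?N"
    using False assms(2) by (simp add: Lq_norm_def r_def[symmetric] ennpowr_cmult)
  also have "(R ^ DIM('a)) powr (1 / r) = R powr exp_ratio (real DIM('a)) q"
    using assms(2) False by (simp add: exp_ratio_def r_def powr_powr flip: powr_realpow)
  finally show ?thesis
    by simp
qed

lemma av_rescale: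
  fixes u :: "'a::euclidean_space \<Rightarrow> real"
  assumes [measurable]: "u \<in> borel_measurable borel" and "0 < R" "0 < \<rho>"
  shows "av (\<lambda>x. u (x0 + R *\<^sub>R x)) (ball 0 \<rho>) = av u (ball x0 (R * \<rho>))"
proof -
  define F where "F x = indicator (ball x0 (R * \<rho>)) x *\<^sub>R u x" for x
  have [measurable]: "F \<in> borel_measurable borel"
    unfolding F_def by measurable
  have "(LINT x|lborel. F x)
      = (LINT x|density (distr lborel borel (\<lambda>x. x0 + R *\<^sub>R x)) (\<lambda>_. ennreal (\<bar>R\<bar> ^ DIM('a))). F x)"
    using lborel_affine[of R x0] assms(2) by simp
  also have "\<dots> = R ^ DIM('a) * (LINT x|lborel. F (x0 + R *\<^sub>R x))"
    using assms(2) by (simp add: integral_density integral_distr)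
  also have "(\<lambda>x. F (x0 + R *\<^sub>R x)) = (\<lambda>x. indicator (ball 0 \<rho>) x *\<^sub>R u (x0 + R *\<^sub>R x))"
    unfolding F_def indicator_def affine_in_ball_iff[OF assms(2)] ..
  finally have "(LINT x:ball x0 (R * \<rho>)|lborel. u x) = R ^ DIM('a) * (LINT x:ball 0 \<rho>|lborel. u (x0 + R *\<^sub>R x))"
    by (simp add: set_lebesgue_integral_def F_def)
  then show ?thesis
    using assms(2,3) by (simp add: av_def content_ball power_mult_distrib)
qed

lemma gagliardo_rescale:
  fixes u :: "'a::euclidean_space \<Rightarrow> real"
  assumes [measurable]: "u \<in> borel_measurable borel" and "0 < R"
  shows "gagliardo s p (ball 0 1) UNIV (\<lambda>x. u (x0 + R *\<^sub>R x))
    = ennreal (R powr (s * p - real DIM('a))) * gagliardo s p (ball x0 R) UNIV u"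
proof -
  define \<gamma> where "\<gamma> = real DIM('a) + s * p"
  define J where "J = ennreal (R ^ DIM('a))"
  define K where "K x y = ennreal (gagliardo_kernel s p u x y)" for x y
  have [measurable]: "(\<lambda>z. K (f z) (g z)) \<in> borel_measurable M"
    if "f \<in> borel_measurable M" "g \<in> borel_measurable M" for f g :: "'z \<Rightarrow> 'a" and M
    unfolding K_def using that by measurable
  have "gagliardo s p (ball x0 R) UNIV u = (\<integral>\<^sup>+x. (\<integral>\<^sup>+y. K x y * indicator (ball x0 R) x \<partial>lborel) \<partial>lborel)"
    by (subst gagliardo_iterated) (auto simp: K_def)
  also have "\<dots> = J * (\<integral>\<^sup>+x. (\<integral>\<^sup>+y. K (x0 + R *\<^sub>R x) y * indicator (ball x0 R) (x0 + R *\<^sub>R x) \<partial>lborel) \<partial>lborel)"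
    unfolding J_def by (rule nn_integral_lborel_affine) (measurable, use assms(2) in simp)
  also have "\<dots> = J * (\<integral>\<^sup>+x. J * (\<integral>\<^sup>+y. K (x0 + R *\<^sub>R x) (x0 + R *\<^sub>R y) * indicator (ball x0 R) (x0 + R *\<^sub>R x) \<partial>lborel) \<partial>lborel)"
    unfolding J_def
    by (intro arg_cong2[where f = "(*)"] nn_integral_cong refl nn_integral_lborel_affine)
      (measurable, use assms(2) in simp)
  also have "\<dots> = J * J * (\<integral>\<^sup>+x. (\<integral>\<^sup>+y. K (x0 + R *\<^sub>R x) (x0 + R *\<^sub>R y) * indicator (ball 0 1) x \<partial>lborel) \<partial>lborel)"
    using affine_in_ball_iff[OF assms(2), of x0 _ 1]
    by (simp add: nn_integral_cmult mult.assoc indicator_def)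
  finally have u: "gagliardo s p (ball x0 R) UNIV u
      = J * J * (\<integral>\<^sup>+x. (\<integral>\<^sup>+y. K (x0 + R *\<^sub>R x) (x0 + R *\<^sub>R y) * indicator (ball 0 1) x \<partial>lborel) \<partial>lborel)" .
  have kernel: "gagliardo_kernel s p (\<lambda>x. u (x0 + R *\<^sub>R x)) x y
      = R powr \<gamma> * gagliardo_kernel s p u (x0 + R *\<^sub>R x) (x0 + R *\<^sub>R y)" for x y
  proof -
    have "norm ((x0 + R *\<^sub>R x) - (x0 + R *\<^sub>R y)) = R * norm (x - y)"
      using assms(2) by (simp flip: scaleR_diff_right)
    then show ?thesis
      using assms(2) by (simp add: gagliardo_kernel_def powr_mult \<gamma>_def[symmetric])
  qed
  have "gagliardo s p (ball 0 1) UNIV (\<lambda>x. u (x0 + R *\<^sub>R x))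
      = (\<integral>\<^sup>+x. (\<integral>\<^sup>+y. ennreal (R powr \<gamma>) * (K (x0 + R *\<^sub>R x) (x0 + R *\<^sub>R y) * indicator (ball 0 1) x) \<partial>lborel) \<partial>lborel)"
    by (subst gagliardo_iterated) (auto simp: K_def kernel ennreal_mult' mult.assoc)
  also have "\<dots> = ennreal (R powr \<gamma>) *
      (\<integral>\<^sup>+x. (\<integral>\<^sup>+y. K (x0 + R *\<^sub>R x) (x0 + R *\<^sub>R y) * indicator (ball 0 1) x \<partial>lborel) \<partial>lborel)"
    by (simp add: nn_integral_cmult)
  also have "ennreal (R powr \<gamma>) = ennreal (R powr (s * p - real DIM('a))) * (J * J)"
    unfolding J_def using assms(2)
    by (simp add: \<gamma>_def powr_add powr_diff powr_realpow flip: ennreal_mult')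
  finally show ?thesis
    unfolding u by (simp add: mult.assoc)
qed

lemma gagliardo_cmult:
  fixes u :: "'a::euclidean_space \<Rightarrow> real"
  assumes [measurable]: "u \<in> borel_measurable borel" "A \<in> sets borel" "B \<in> sets borel" and "0 < c"
  shows "gagliardo s p A B (\<lambda>x. c * u x) = ennreal (c powr p) * gagliardo s p A B u"
proof -
  have "gagliardo_kernel s p (\<lambda>x. c * u x) x y = c powr p * gagliardo_kernel s p u x y" for x y
    using assms(4) by (simp add: gagliardo_kernel_def abs_mult powr_mult flip: right_diff_distrib)
  then show ?thesis
    by (simp add: gagliardo_iterated ennreal_mult' mult.assoc nn_integral_cmult)
qed

text \<open>
  Pairs with both points outside \<open>A\<close> do not contribute, and the two orders of the remaining pairs
  are exchanged by the symmetry of the kernel.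
\<close>

lemma gagliardo_supported_le:
  fixes u :: "'a::euclidean_space \<Rightarrow> real"
  assumes [measurable]: "u \<in> borel_measurable borel" "A \<in> sets borel" and supp: "\<And>x. x \<notin> A \<Longrightarrow> u x = 0"
  shows "gagliardo s p UNIV UNIV u \<le> 2 * gagliardo s p A UNIV u"
proof -
  define K where "K x y = ennreal (gagliardo_kernel s p u x y)" for x y
  have [measurable]: "(\<lambda>z. K (f z) (g z)) \<in> borel_measurable M"
    if "f \<in> borel_measurable M" "g \<in> borel_measurable M" for f g :: "'z \<Rightarrow> 'a" and M
    unfolding K_def using that by measurable
  have K0: "K x y = 0" if "x \<notin> A" "y \<notin> A" for x y
    using supp[OF that(1)] supp[OF that(2)] by (simp add: K_def gagliardo_kernel_def)
  have half: "gagliardo s p A UNIV u = (\<integral>\<^sup>+x. (\<integral>\<^sup>+y. K x y * indicator A x \<partial>lborel) \<partial>lborel)"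
    by (subst gagliardo_iterated) (auto simp: K_def)
  have swap: "(\<integral>\<^sup>+x. (\<integral>\<^sup>+y. K x y * indicator A y \<partial>lborel) \<partial>lborel) = gagliardo s p A UNIV u"
  proof -
    have "(\<integral>\<^sup>+x. (\<integral>\<^sup>+y. K x y * indicator A y \<partial>lborel) \<partial>lborel) = (\<integral>\<^sup>+x. (\<integral>\<^sup>+y. K y x * indicator A x \<partial>lborel) \<partial>lborel)"
      by (rule lborel_pair.Fubini') measurable
    then show ?thesis
      unfolding half by (simp add: K_def gagliardo_kernel_commute)
  qed
  have "gagliardo s p UNIV UNIV u = (\<integral>\<^sup>+x. (\<integral>\<^sup>+y. K x y \<partial>lborel) \<partial>lborel)"
    unfolding K_def by (subst gagliardo_iterated) auto
  also have "\<dots> \<le> (\<integral>\<^sup>+x. (\<integral>\<^sup>+y. K x y * indicator A x + K x y * indicator A y \<partial>lborel) \<partial>lborel)"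
    by (intro nn_integral_mono) (auto simp: indicator_def K0)
  also have "\<dots> = gagliardo s p A UNIV u + (\<integral>\<^sup>+x. (\<integral>\<^sup>+y. K x y * indicator A y \<partial>lborel) \<partial>lborel)"
    unfolding half by (simp add: nn_integral_add)
  also have "\<dots> = 2 * gagliardo s p A UNIV u"
    unfolding swap by (simp add: mult_2)
  finally show ?thesis .
qed

section \<open>The inequality on the unit ball\<close>

lemma test_functions_continuous: "u \<in> test_functions \<Omega> \<Longrightarrow> continuous_on UNIV u"
  by (metis (no_types, lifting) Ck.simps(1) mem_Collect_eq test_functions_def)

lemma test_functions_cmult:
  assumes "u \<in> test_functions \<Omega>" and "c \<noteq> 0"
  shows "(\<lambda>x. c * u x) \<in> test_functions \<Omega>"
proof -
  have "{x. c * u x \<noteq> 0} = {x. u x \<noteq> 0}"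
    using assms(2) by auto
  then show ?thesis
    using assms(1) by (auto simp: test_functions_def intro!: Ck_mult Ck_const)
qed

text \<open>
  The infimum is taken over functions of norm \<open>1\<close>; dividing by the norm, which is positive and finite unless the left-hand side
  vanishes, gives the homogeneous form.
\<close>

lemma lam_mult_Lq_norm_le:
  fixes \<phi> :: "'a::euclidean_space \<Rightarrow> real"
  assumes \<phi>: "\<phi> \<in> test_functions (ball 0 1)" and q: "1 \<le> q"
  shows "lam s p q (ball (0::'a) 1) * ennpowr (Lq_norm q (ball 0 1) \<phi>) p \<le> gagliardo s p UNIV UNIV \<phi>"
proof -
  have cont: "continuous_on UNIV \<phi>"
    using \<phi> by (rule test_functions_continuous)
  then have [measurable]: "\<phi> \<in> borel_measurable borel"
    by (rule borel_measurable_continuous_onI)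
  have "compact (\<phi> ` cball 0 1)"
    by (intro compact_continuous_image continuous_on_subset[OF cont]) auto
  then obtain K where "\<forall>z\<in>\<phi> ` cball 0 1. norm z \<le> K"
    using bounded_iff compact_imp_bounded by blast
  then have "Lq_norm q (ball 0 1) \<phi> < \<infinity>"
    by (intro Lq_norm_bounded_less_top[where K = K]) (auto simp: emeasure_ball)
  then obtain n where n: "Lq_norm q (ball 0 1) \<phi> = ennreal n" "0 \<le> n"
    by (cases "Lq_norm q (ball 0 1) \<phi>") auto
  show ?thesis
  proof (cases "n = 0")
    case True
    then show ?thesis
      by (simp add: n(1) ennpowr_def)
  next
    case False
    with n have "0 < n" by simp
    define \<psi> where "\<psi> x = (1 / n) * \<phi> x" for x
    have "Lq_norm q (ball 0 1) \<psi> = ennreal (1 / n) * ennreal n"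
      unfolding \<psi>_def n(1)[symmetric] by (rule Lq_norm_cmult) (use q \<open>0 < n\<close> in auto)
    also have "\<dots> = 1"
      using \<open>0 < n\<close> by (simp flip: ennreal_mult')
    finally have norm_1: "Lq_norm q (ball 0 1) \<psi> = 1" .
    have "\<psi> \<in> test_functions (ball 0 1)"
      unfolding \<psi>_def[abs_def] by (rule test_functions_cmult[OF \<phi>]) (use \<open>0 < n\<close> in simp)
    with norm_1 have "lam s p q (ball (0::'a) 1) \<le> gagliardo s p UNIV UNIV \<psi>"
      unfolding lam_def by (intro INF_lower) auto
    also have "\<dots> = ennreal ((1 / n) powr p) * gagliardo s p UNIV UNIV \<phi>"
      unfolding \<psi>_def by (rule gagliardo_cmult) (use \<open>0 < n\<close> in auto)
    finally have "lam s p q (ball (0::'a) 1) * ennreal (n powr p)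
        \<le> ennreal ((1 / n) powr p) * gagliardo s p UNIV UNIV \<phi> * ennreal (n powr p)"
      by (rule mult_right_mono) simp
    also have "\<dots> = (ennreal ((1 / n) powr p) * ennreal (n powr p)) * gagliardo s p UNIV UNIV \<phi>"
      by (simp only: mult_ac)
    also have "ennreal ((1 / n) powr p) * ennreal (n powr p) = 1"
      using \<open>0 < n\<close> by (simp add: powr_divide flip: ennreal_mult')
    finally show ?thesis
      using n by (simp add: ennpowr_def)
  qed
qed

text \<open>
  Product rule in the form \<open>\<phi> x - \<phi> y = \<eta> y (v x - v y) + (v x - c) (\<eta> x - \<eta> y)\<close>. Placing \<open>v x - c\<close> at the point
  \<open>x\<close>, which stays in the ball, keeps values of \<open>v - c\<close> far away out of the estimate.
\<close>

lemma gagliardo_cutoff_le: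
  fixes v \<eta> :: "'a::euclidean_space \<Rightarrow> real"
  assumes [measurable]: "v \<in> borel_measurable borel" "\<eta> \<in> borel_measurable borel"
    and \<eta>: "\<And>x. 0 \<le> \<eta> x" "\<And>x. \<eta> x \<le> 1" "\<And>x y. \<bar>\<eta> x - \<eta> y\<bar> \<le> L * norm (x - y)" and "0 < L"
    and p: "1 \<le> p" and s: "0 < s" "s < 1"
  shows "gagliardo s p (ball 0 1) UNIV (\<lambda>x. (v x - c) * \<eta> x)
    \<le> ennreal (2 powr (p - 1)) * (gagliardo s p (ball 0 1) UNIV v
      + ennreal (L powr (s * p) * (unit_ball_vol (real DIM('a)) * 2 ^ Suc DIM('a) / (s * (1 - s))))
        * (\<integral>\<^sup>+x\<in>ball 0 1. ennreal (\<bar>v x - c\<bar> powr p) \<partial>lborel))"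
proof -
  define \<phi> where "\<phi> x = (v x - c) * \<eta> x" for x
  have [measurable]: "\<phi> \<in> borel_measurable borel"
    unfolding \<phi>_def by measurable
  define Q where "Q = L powr (s * p) * (unit_ball_vol (real DIM('a)) * 2 ^ Suc DIM('a) / (s * (1 - s)))"
  define B where "B = ball (0::'a) 1"
  have [measurable]: "B \<in> sets borel"
    by (simp add: B_def)
  define k where "k u x y = ennreal (gagliardo_kernel s p u x y)" for u and x y :: 'a
  have [measurable]: "(\<lambda>z. k u (f z) (g z)) \<in> borel_measurable M"
    if "u \<in> borel_measurable borel" "f \<in> borel_measurable M" "g \<in> borel_measurable M"
    for u and f g :: "'z \<Rightarrow> 'a" and M
    unfolding k_def using that by measurable
  have pointwise: "k \<phi> x y \<le> ennreal (2 powr (p - 1)) * (k v x y + ennreal (\<bar>v x - c\<bar> powr p) * k \<eta> x y)" for x y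
  proof -
    have "\<phi> x - \<phi> y = \<eta> y * (v x - v y) + (v x - c) * (\<eta> x - \<eta> y)"
      by (simp add: \<phi>_def algebra_simps)
    then have "\<bar>\<phi> x - \<phi> y\<bar> powr p
        \<le> 2 powr (p - 1) * (\<bar>\<eta> y * (v x - v y)\<bar> powr p + \<bar>(v x - c) * (\<eta> x - \<eta> y)\<bar> powr p)"
      using abs_add_powr_le[OF p] by metis
    also have "\<dots> \<le> 2 powr (p - 1) * (\<bar>v x - v y\<bar> powr p + \<bar>v x - c\<bar> powr p * \<bar>\<eta> x - \<eta> y\<bar> powr p)"
    proof (intro mult_left_mono add_mono)
      have "\<bar>\<eta> y * (v x - v y)\<bar> \<le> 1 * \<bar>v x - v y\<bar>"
        unfolding abs_mult using \<eta>(1,2)[of y] by (intro mult_right_mono) auto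
      then show "\<bar>\<eta> y * (v x - v y)\<bar> powr p \<le> \<bar>v x - v y\<bar> powr p"
        using p by (intro powr_mono2) auto
    qed (auto simp: abs_mult powr_mult)
    finally have "gagliardo_kernel s p \<phi> x y
        \<le> 2 powr (p - 1) * (\<bar>v x - v y\<bar> powr p + \<bar>v x - c\<bar> powr p * \<bar>\<eta> x - \<eta> y\<bar> powr p)
          / norm (x - y) powr (real DIM('a) + s * p)"
      unfolding gagliardo_kernel_def by (rule divide_right_mono) simp
    also have "\<dots> = 2 powr (p - 1) * (gagliardo_kernel s p v x y + \<bar>v x - c\<bar> powr p * gagliardo_kernel s p \<eta> x y)"
      by (simp add: gagliardo_kernel_def add_divide_distrib distrib_left)
    finally have "k \<phi> x y \<le> ennreal (2 powr (p - 1) * (gagliardo_kernel s p v x y + \<bar>v x - c\<bar> powr p * gagliardo_kernel s p \<eta> x y))"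
      unfolding k_def by (rule ennreal_leI)
    then show ?thesis
      by (simp add: k_def ennreal_mult' gagliardo_kernel_nonneg)
  qed
  have kernel: "(\<integral>\<^sup>+y. k \<eta> x y \<partial>lborel) \<le> ennreal Q" for x
    unfolding k_def Q_def
  proof (rule nn_integral_kernel_lipschitz_le)
    show "\<bar>\<eta> x - \<eta> y\<bar> \<le> 1" for y
      using \<eta>(1,2)[of x] \<eta>(1,2)[of y] by (auto simp: abs_le_iff)
  qed (use assms in auto)
  have "gagliardo s p B UNIV \<phi> = (\<integral>\<^sup>+x. (\<integral>\<^sup>+y. k \<phi> x y * indicator B x \<partial>lborel) \<partial>lborel)"
    unfolding k_def by (subst gagliardo_iterated) auto
  also have "\<dots> \<le> (\<integral>\<^sup>+x. (\<integral>\<^sup>+y. ennreal (2 powr (p - 1)) * (k v x y * indicator B x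
      + ennreal (\<bar>v x - c\<bar> powr p) * indicator B x * k \<eta> x y) \<partial>lborel) \<partial>lborel)"
    by (intro nn_integral_mono) (use pointwise in \<open>auto simp: indicator_def\<close>)
  also have "\<dots> = ennreal (2 powr (p - 1)) * ((\<integral>\<^sup>+x. (\<integral>\<^sup>+y. k v x y * indicator B x \<partial>lborel) \<partial>lborel)
      + (\<integral>\<^sup>+x. ennreal (\<bar>v x - c\<bar> powr p) * indicator B x * (\<integral>\<^sup>+y. k \<eta> x y \<partial>lborel) \<partial>lborel))"
    by (simp add: nn_integral_cmult nn_integral_add)
  also have "\<dots> \<le> ennreal (2 powr (p - 1)) * ((\<integral>\<^sup>+x. (\<integral>\<^sup>+y. k v x y * indicator B x \<partial>lborel) \<partial>lborel)
      + (\<integral>\<^sup>+x. ennreal (\<bar>v x - c\<bar> powr p) * indicator B x * ennreal Q \<partial>lborel))"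
    by (intro mult_left_mono add_left_mono nn_integral_mono kernel) auto
  also have "\<dots> = ennreal (2 powr (p - 1)) * (gagliardo s p B UNIV v
      + ennreal Q * (\<integral>\<^sup>+x\<in>B. ennreal (\<bar>v x - c\<bar> powr p) \<partial>lborel))"
  proof -
    have "(\<integral>\<^sup>+x. ennreal (\<bar>v x - c\<bar> powr p) * indicator B x * ennreal Q \<partial>lborel)
        = (\<integral>\<^sup>+x\<in>B. ennreal (\<bar>v x - c\<bar> powr p) \<partial>lborel) * ennreal Q"
      by (rule nn_integral_multc) measurable
    moreover have "gagliardo s p B UNIV v = (\<integral>\<^sup>+x. (\<integral>\<^sup>+y. k v x y * indicator B x \<partial>lborel) \<partial>lborel)"
      unfolding k_def by (subst gagliardo_iterated) auto
    ultimately show ?thesis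
      by (simp add: mult.commute[of _ "ennreal Q"])
  qed
  finally show ?thesis
    unfolding \<phi>_def Q_def B_def .
qed

lemma bump_borel_measurable [measurable]: "bump a b \<in> borel_measurable borel"
  by (rule borel_measurable_continuous_onI) (use Ck_bump[of 0 a b] in simp)

text \<open>
  If the infimum ranged only over functions of infinite seminorm, the right-hand side of the final inequality would
  degenerate to \<open>0\<close>. A single cutoff, viewed as the product with the constant function \<open>1\<close>, excludes this.
\<close>

lemma lam_less_top:
  assumes p: "1 \<le> p" and s: "0 < s" "s < 1" and q: "1 \<le> q"
  shows "lam s p q (ball (0::'a::euclidean_space) 1) < \<infinity>"
proof -
  define \<eta> :: "'a \<Rightarrow> real" where "\<eta> = bump (1 / 4) (1 / 2)"
  note bounds = bump_bounds[where 'a = 'a, of "1 / 4" "1 / 2", folded \<eta>_def]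
  have [measurable]: "\<eta> \<in> borel_measurable borel"
    by (simp add: \<eta>_def)
  have test: "\<eta> \<in> test_functions (ball 0 1)"
    using mult_bump_test_function[of "\<lambda>_. 1" "1 / 4" "1 / 2"] by (simp add: Ck_const \<eta>_def)
  \<comment> \<open>Below, \<open>32\<close> is the Lipschitz constant \<open>8 / (1 / 2 - 1 / 4)\<close> of the cutoff.\<close>
  have "gagliardo s p UNIV UNIV \<eta> \<le> 2 * gagliardo s p (ball 0 1) UNIV \<eta>"
    by (rule gagliardo_supported_le) (use bounds(4) in auto)
  also have "gagliardo s p (ball 0 1) UNIV \<eta> = gagliardo s p (ball 0 1) UNIV (\<lambda>x. (1 - 0) * \<eta> x)"
    by simp
  also have "2 * \<dots> < \<infinity>"
  proof -
    have "gagliardo s p (ball 0 1) UNIV (\<lambda>x. (1 - 0) * \<eta> x)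
      \<le> ennreal (2 powr (p - 1)) * (gagliardo s p (ball (0::'a) 1) UNIV (\<lambda>_. 1)
      + ennreal (32 powr (s * p) * (unit_ball_vol (real DIM('a)) * 2 ^ Suc DIM('a) / (s * (1 - s))))
        * (\<integral>\<^sup>+x\<in>ball (0::'a) 1. ennreal (\<bar>1 - 0\<bar> powr p) \<partial>lborel))"
      using bump_lipschitz[where 'a = 'a, of "1 / 4" "1 / 2", folded \<eta>_def] bounds(1,2) p s
      by (intro gagliardo_cutoff_le) auto
    also have "\<dots> < \<infinity>"
      by (simp add: ennreal_mult_less_top emeasure_ball gagliardo_def)
    finally show ?thesis
      by (simp add: ennreal_mult_less_top)
  qed
  finally have fin: "gagliardo s p UNIV UNIV \<eta> < \<infinity>" .
  have "Lq_norm q (ball 0 1) \<eta> \<noteq> 0"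
  proof
    assume "Lq_norm q (ball 0 1) \<eta> = 0"
    then have "AE x in lborel. x \<in> ball 0 1 \<longrightarrow> \<eta> x = 0"
      by (subst (asm) Lq_norm_eq_0_iff) auto
    then have "AE x in lborel. x \<notin> ball (0::'a) (1 / 4)"
    proof eventually_elim
      case (elim x)
      show ?case
      proof
        assume "x \<in> ball 0 (1 / 4)"
        then have "x \<in> ball 0 1" "exp (-1) \<le> \<eta> x"
          by (auto intro!: bounds(3))
        then show False
          using elim by auto
      qed
    qed
    then have "ball (0::'a) (1 / 4) \<in> null_sets lborel"
      by (subst AE_iff_null_sets) auto
    then have "emeasure lborel (ball (0::'a) (1 / 4)) = 0"
      by (rule null_setsD1)
    moreover define m where "m = unit_ball_vol (real DIM('a)) * (1 / 4) ^ DIM('a)"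
    have "0 < m"
      by (simp add: m_def unit_ball_vol_pos)
    moreover have "emeasure lborel (ball (0::'a) (1 / 4)) = ennreal m"
      unfolding m_def by (rule emeasure_ball) simp
    ultimately show False
      by simp
  qed
  then have pos: "ennpowr (Lq_norm q (ball 0 1) \<eta>) p \<noteq> 0"
    by (simp add: ennpowr_eq_0_iff)
  show ?thesis
  proof (rule ccontr)
    assume "\<not> ?thesis"
    then have "lam s p q (ball (0::'a) 1) = \<infinity>"
      by (simp add: not_less top_unique)
    then show False
      using lam_mult_Lq_norm_le[OF test q, of s p] fin pos by (simp add: ennreal_top_mult top_unique)
  qed
qed

text \<open>
  By Jensen, the deviation from the average over the small ball is at most the mean of \<open>\<bar>v x - v y\<bar>\<^sup>p\<close> over \<open>y\<close> in that ball,
  whose integral over \<open>x\<close> the oscillation bounds.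
\<close>

lemma deviation_le_gagliardo:
  fixes v :: "'a::euclidean_space \<Rightarrow> real"
  assumes v: "continuous_on UNIV v" and \<rho>: "0 < \<rho>" "\<rho> < 1" and p: "1 \<le> p" and s: "0 < s" "s < 1"
  shows "(\<integral>\<^sup>+x\<in>ball 0 1. ennreal (\<bar>v x - av v (ball 0 \<rho>)\<bar> powr p) \<partial>lborel)
    \<le> ennreal (p * 2 powr (2 * real DIM('a) + 3 * p + 1) * (s * (1 - s)) / (unit_ball_vol (real DIM('a)) * \<rho> ^ DIM('a)))
      * gagliardo s p (ball 0 1) UNIV v"
    (is "?X \<le> ennreal (?C / ?m) * ?G")
proof -
  have [measurable]: "v \<in> borel_measurable borel"
    using v by (rule borel_measurable_continuous_onI)
  have m: "0 < ?m" "emeasure lborel (ball (0::'a) \<rho>) = ennreal ?m"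
    using \<rho> by (auto simp: emeasure_ball unit_ball_vol_pos)
  have "?X * ennreal ?m = (\<integral>\<^sup>+x. ennreal (\<bar>v x - av v (ball 0 \<rho>)\<bar> powr p) * indicator (ball 0 1) x * ennreal ?m \<partial>lborel)"
    by (rule nn_integral_multc[symmetric]) measurable
  also have "\<dots> \<le> oscillation p v"
    unfolding oscillation_def
  proof (rule nn_integral_mono)
    fix x :: 'a
    have "ennreal (\<bar>v x - av v (ball 0 \<rho>)\<bar> powr p) * ennreal ?m
        \<le> (\<integral>\<^sup>+y\<in>ball 0 \<rho>. ennreal (\<bar>v x - v y\<bar> powr p) \<partial>lborel)"
      using abs_average_powr_le[OF p v \<rho>(1), of "v x" 0] unfolding m(2) .
    also have "\<dots> \<le> (\<integral>\<^sup>+y\<in>ball 0 1. ennreal (\<bar>v x - v y\<bar> powr p) \<partial>lborel)"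
      using \<rho> by (intro nn_integral_mono) (auto simp: indicator_def)
    finally show "ennreal (\<bar>v x - av v (ball 0 \<rho>)\<bar> powr p) * indicator (ball 0 1) x * ennreal ?m
        \<le> (\<integral>\<^sup>+y. ennreal (\<bar>v x - v y\<bar> powr p) * indicator (ball 0 1) x * indicator (ball 0 1) y \<partial>lborel)"
      by (auto simp: indicator_def)
  qed
  also have "\<dots> \<le> ennreal ?C * ?G"
    by (rule oscillation_le[OF _ p s]) measurable
  finally have "?X * ennreal ?m * ennreal (1 / ?m) \<le> ennreal ?C * ?G * ennreal (1 / ?m)"
    by (rule mult_right_mono) simp
  moreover have "?X * ennreal ?m * ennreal (1 / ?m) = ?X"
  proof -
    have "ennreal ?m * ennreal (1 / ?m) = ennreal (?m * (1 / ?m))"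
      by (rule ennreal_mult'[symmetric]) (use m(1) in simp)
    also have "?m * (1 / ?m) = 1"
    proof -
      have "k * (1 / k) = 1" if "0 < k" for k :: real
        using that by simp
      from this[OF m(1)] show ?thesis .
    qed
    finally show ?thesis
      by (simp add: mult.assoc)
  qed
  moreover have "ennreal ?C * ?G * ennreal (1 / ?m) = (ennreal ?C * ennreal (1 / ?m)) * ?G"
    by (simp only: mult_ac)
  moreover have "ennreal ?C * ennreal (1 / ?m) = ennreal (?C * (1 / ?m))"
    by (rule ennreal_mult'[symmetric]) (use p s in simp)
  ultimately show ?thesis
    by simp
qed

text \<open>
  The factors come from the lower bound \<open>1 / e\<close> of the cutoff on the small ball, from the convexity inequality together
  with the symmetrisation of the seminorm, and from the two terms of the product rule.
\<close>

definition shape_const :: "nat \<Rightarrow> real \<Rightarrow> real" where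
  "shape_const N p = exp p * 2 powr p * (1 + 16 powr p * 2 ^ Suc N * (p * 2 powr (2 * real N + 3 * p + 1)))"

text \<open>
  In the case \<open>\<Lambda> = 0\<close> the quotient \<open>Z / \<Lambda>\<close> is infinite unless \<open>Z = 0\<close>, which is the reason for the last hypothesis.
\<close>

lemma ennreal_le_divideI:
  fixes \<Lambda> Y Z :: ennreal
  assumes "\<Lambda> * Y \<le> Z" "\<Lambda> < \<infinity>" "Z = 0 \<Longrightarrow> Y = 0"
  shows "Y \<le> Z / \<Lambda>"
proof (cases "\<Lambda> = 0")
  case True
  then show ?thesis
    using assms(3) by (cases "Z = 0") (auto simp: ennreal_divide_zero ennreal_mult_top divide_ennreal_def)
next
  case False
  have "Y = \<Lambda> * Y / \<Lambda>"
    using False assms(2) by (simp add: mult.commute[of \<Lambda>] mult_divide_eq_ennreal)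
  also have "\<dots> \<le> Z / \<Lambda>"
    using assms(1) by (rule divide_right_mono_ennreal)
  finally show ?thesis .
qed

text \<open>
  The heart of the proof: the function \<open>(v - c) \<eta>\<close> is a competitor for \<open>\<lambda>\<close>. If the seminorm of \<open>v\<close> vanishes, so does its
  deviation; otherwise the right-hand side is infinite when \<open>\<lambda> = 0\<close>.
\<close>

lemma sobolev_deviation_unit_ball:
  fixes v :: "'a::euclidean_space \<Rightarrow> real"
  assumes smooth: "\<And>k. Ck k v" and \<rho>: "0 < \<rho>" "\<rho> < 1"
    and p: "1 \<le> p" and s: "0 < s" "s < 1" and q: "1 \<le> q"
  shows "ennpowr (Lq_norm q (ball 0 \<rho>) (\<lambda>x. v x - av v (ball 0 \<rho>))) p
    \<le> ennreal (shape_const DIM('a) p * (1 / \<rho> ^ DIM('a)) * (1 - \<rho>) powr - (s * p))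
      * (gagliardo s p (ball 0 1) UNIV v / lam s p q (ball (0::'a) 1))"
proof -
  define N where "N = DIM('a)"
  define \<omega> where "\<omega> = unit_ball_vol (real N)"
  have \<omega>: "0 < \<omega>" by (simp add: \<omega>_def unit_ball_vol_pos)
  define A where "A = p * 2 powr (2 * real N + 3 * p + 1)"
  have A: "0 < A" using p by (simp add: A_def)
  define c where "c = av v (ball 0 \<rho>)"
  \<comment> \<open>The support must be a compact subset of the open unit ball; any fixed fraction of the gap would do.\<close>
  define b where "b = (1 + \<rho>) / 2"
  define L where "L = 16 / (1 - \<rho>)"
  define \<eta> :: "'a \<Rightarrow> real" where "\<eta> = bump \<rho> b"
  define \<phi> where "\<phi> x = (v x - c) * \<eta> x" for x
  define G where "G = gagliardo s p (ball 0 1) UNIV v"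
  define X where "X = (\<integral>\<^sup>+x\<in>ball 0 1. ennreal (\<bar>v x - c\<bar> powr p) \<partial>lborel)"
  define Y where "Y = ennpowr (Lq_norm q (ball 0 \<rho>) (\<lambda>x. v x - c)) p"
  define F where "F = (1 / \<rho> ^ N) * (1 - \<rho>) powr - (s * p)"
  define \<Lambda> where "\<Lambda> = lam s p q (ball (0::'a) 1)"
  have b: "\<rho> < b" "b < 1" and L: "0 < L" "8 / (b - \<rho>) = L"
    using \<rho> by (auto simp: b_def L_def field_simps)
  note bounds = bump_bounds[where 'a = 'a, OF \<rho>(1) b(1), folded \<eta>_def]
  have v_cont: "continuous_on UNIV v"
    using smooth[of 0] by simp
  then have [measurable]: "v \<in> borel_measurable borel"
    by (rule borel_measurable_continuous_onI)
  have [measurable]: "\<eta> \<in> borel_measurable borel"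
    by (simp add: \<eta>_def)
  have [measurable]: "\<phi> \<in> borel_measurable borel"
    unfolding \<phi>_def by measurable
  have "Ck k (\<lambda>x. v x + (- c))" for k
    by (intro Ck_add Ck_const smooth)
  then have test: "\<phi> \<in> test_functions (ball 0 1)"
    unfolding \<phi>_def \<eta>_def by (intro mult_bump_test_function \<rho> b) simp
  have X: "X \<le> ennreal (A * (s * (1 - s)) / (\<omega> * \<rho> ^ N)) * G"
    unfolding X_def A_def \<omega>_def N_def G_def c_def by (rule deviation_le_gagliardo[OF v_cont \<rho> p s])
  have F: "1 \<le> F"
  proof -
    have "1 \<le> 1 / \<rho> ^ N"
      using \<rho> by (simp add: power_le_one)
    moreover have "(1 - \<rho>) powr 0 \<le> (1 - \<rho>) powr - (s * p)"
      using \<rho> s p by (intro powr_mono') auto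
    then have "1 \<le> (1 - \<rho>) powr - (s * p)"
      using \<rho> by simp
    ultimately have "1 * 1 \<le> F"
      unfolding F_def using \<rho> by (intro mult_mono) auto
    then show ?thesis by simp
  qed
  define Q where "Q = L powr (s * p) * (\<omega> * 2 ^ Suc N / (s * (1 - s)))"
  have Q: "0 \<le> Q"
    using \<omega> s by (simp add: Q_def)
  have QA: "Q * (A * (s * (1 - s)) / (\<omega> * \<rho> ^ N)) \<le> 16 powr p * 2 ^ Suc N * A * F"
  proof -
    have "L powr (s * p) = 16 powr (s * p) * (1 - \<rho>) powr - (s * p)"
      using \<rho> by (simp add: L_def powr_divide powr_minus_divide)
    also have "\<dots> \<le> 16 powr p * (1 - \<rho>) powr - (s * p)"
      using s p by (intro mult_right_mono powr_mono) auto
    finally have "L powr (s * p) * (2 ^ Suc N * A * (1 / \<rho> ^ N))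
        \<le> 16 powr p * (1 - \<rho>) powr - (s * p) * (2 ^ Suc N * A * (1 / \<rho> ^ N))"
      using A \<rho> by (intro mult_right_mono) auto
    moreover have "Q * (A * (s * (1 - s)) / (\<omega> * \<rho> ^ N)) = L powr (s * p) * (2 ^ Suc N * A * (1 / \<rho> ^ N))"
      using \<omega> s by (simp add: Q_def)
    ultimately show ?thesis
      by (simp add: F_def mult_ac)
  qed
  have "gagliardo s p UNIV UNIV \<phi> \<le> 2 * gagliardo s p (ball 0 1) UNIV \<phi>"
    by (rule gagliardo_supported_le) (use bounds(4) b in \<open>auto simp: \<phi>_def\<close>)
  also have "\<dots> \<le> 2 * (ennreal (2 powr (p - 1)) * (G + ennreal Q * X))"
    unfolding \<phi>_def G_def X_def Q_def \<omega>_def N_def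
    using bump_lipschitz[where 'a = 'a, OF \<rho>(1) b(1), folded \<eta>_def, unfolded L(2)]
    by (intro mult_left_mono gagliardo_cutoff_le bounds(1,2) L p s) auto
  also have "\<dots> = ennreal (2 powr p) * (G + ennreal Q * X)"
  proof -
    have "(2::ennreal) * ennreal (2 powr (p - 1)) = ennreal (2 * 2 powr (p - 1))"
      by (subst ennreal_mult') auto
    then show ?thesis
      by (simp add: mult.assoc[symmetric] powr_diff)
  qed
  also have "\<dots> \<le> ennreal (2 powr p) * (ennreal F * G + ennreal (16 powr p * 2 ^ Suc N * A * F) * G)"
  proof (intro mult_left_mono add_mono)
    have "1 * G \<le> ennreal F * G"
      using F by (intro mult_right_mono) (auto simp: ennreal_ge_1)
    then show "G \<le> ennreal F * G"
      by simp
    have "ennreal Q * X \<le> ennreal Q * (ennreal (A * (s * (1 - s)) / (\<omega> * \<rho> ^ N)) * G)"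
      by (intro mult_left_mono X) simp
    also have "\<dots> = ennreal (Q * (A * (s * (1 - s)) / (\<omega> * \<rho> ^ N))) * G"
      by (simp only: ennreal_mult'[OF Q] mult.assoc)
    also have "\<dots> \<le> ennreal (16 powr p * 2 ^ Suc N * A * F) * G"
      by (intro mult_right_mono ennreal_leI QA) simp
    finally show "ennreal Q * X \<le> ennreal (16 powr p * 2 ^ Suc N * A * F) * G" .
  qed simp
  also have "\<dots> = ennreal (2 powr p * (1 + 16 powr p * 2 ^ Suc N * A) * F) * G"
  proof -
    have "ennreal F * G + ennreal (16 powr p * 2 ^ Suc N * A * F) * G = ennreal (F + 16 powr p * 2 ^ Suc N * A * F) * G"
      using F A by (subst ennreal_plus) (auto simp: distrib_right)
    also have "F + 16 powr p * 2 ^ Suc N * A * F = (1 + 16 powr p * 2 ^ Suc N * A) * F"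
      by (simp add: algebra_simps)
    finally show ?thesis
      by (simp add: ennreal_mult' mult.assoc)
  qed
  finally have seminorm: "gagliardo s p UNIV UNIV \<phi> \<le> ennreal (2 powr p * (1 + 16 powr p * 2 ^ Suc N * A) * F) * G" .
  have "Lq_norm q (ball 0 \<rho>) (\<lambda>x. v x - c) \<le> Lq_norm q (ball 0 1) (\<lambda>x. exp 1 * \<phi> x)"
  proof (rule Lq_norm_mono)
    fix x :: 'a assume "x \<in> ball 0 \<rho>"
    then have "exp (-1) \<le> \<eta> x"
      by (intro bounds(3)) simp
    then have "exp 1 * exp (-1) \<le> exp 1 * \<eta> x"
      by (intro mult_left_mono) auto
    then have "1 \<le> exp 1 * \<eta> x"
      by (simp flip: exp_add)
    then have "1 * \<bar>v x - c\<bar> \<le> (exp 1 * \<eta> x) * \<bar>v x - c\<bar>"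
      by (rule mult_right_mono) simp
    then show "\<bar>v x - c\<bar> \<le> \<bar>exp 1 * \<phi> x\<bar>"
      using bounds(1)[of x] by (simp add: \<phi>_def abs_mult mult_ac)
  qed (use \<rho> in auto)
  also have "\<dots> = ennreal (exp 1) * Lq_norm q (ball 0 1) \<phi>"
    by (rule Lq_norm_cmult) (use q in auto)
  finally have "Y \<le> ennpowr (ennreal (exp 1) * Lq_norm q (ball 0 1) \<phi>) p"
    unfolding Y_def using p by (intro ennpowr_mono) auto
  also have "\<dots> = ennreal (exp p) * ennpowr (Lq_norm q (ball 0 1) \<phi>) p"
    by (simp add: ennpowr_cmult powr_def)
  finally have "\<Lambda> * Y \<le> \<Lambda> * (ennreal (exp p) * ennpowr (Lq_norm q (ball 0 1) \<phi>) p)"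
    by (rule mult_left_mono) simp
  also have "\<dots> = ennreal (exp p) * (\<Lambda> * ennpowr (Lq_norm q (ball 0 1) \<phi>) p)"
    by (simp only: mult_ac)
  also have "\<dots> \<le> ennreal (exp p) * (ennreal (2 powr p * (1 + 16 powr p * 2 ^ Suc N * A) * F) * G)"
    unfolding \<Lambda>_def
    by (intro mult_left_mono order_trans[OF lam_mult_Lq_norm_le[OF test q] seminorm]) simp
  also have "\<dots> = ennreal (shape_const N p * F) * G"
    by (simp add: shape_const_def A_def ennreal_mult' mult.assoc)
  finally have main: "\<Lambda> * Y \<le> ennreal (shape_const N p * F) * G" .
  have pos: "0 < shape_const N p * F"
    unfolding shape_const_def A_def[symmetric] using A F by (intro mult_pos_pos add_pos_nonneg) auto
  have zero: "Y = 0" if "G = 0"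
  proof -
    have "X = 0"
      using X that by simp
    then have "AE x in lborel. ennreal (\<bar>v x - c\<bar> powr p) * indicator (ball 0 1) x = 0"
      unfolding X_def by (subst (asm) nn_integral_0_iff_AE) auto
    then have "AE x in lborel. x \<in> ball 0 \<rho> \<longrightarrow> v x - c = 0"
      by eventually_elim (use \<rho> in \<open>auto simp: indicator_def split: if_splits\<close>)
    then have "Lq_norm q (ball 0 \<rho>) (\<lambda>x. v x - c) = 0"
      by (subst Lq_norm_eq_0_iff) auto
    then show ?thesis
      by (simp add: Y_def ennpowr_eq_0_iff)
  qed
  have "Y \<le> ennreal (shape_const N p * F) * G / \<Lambda>"
  proof (rule ennreal_le_divideI[OF main])
    show "\<Lambda> < \<infinity>"
      unfolding \<Lambda>_def by (rule lam_less_top[OF p s q])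
    show "Y = 0" if "ennreal (shape_const N p * F) * G = 0"
      using that pos by (intro zero) auto
  qed
  then show ?thesis
    unfolding Y_def c_def \<Lambda>_def G_def F_def N_def by (simp add: ennreal_times_divide mult.assoc)
qed

section \<open>The weight and the general ball\<close>

text \<open>
  For \<open>s p < N\<close> the condition \<open>q \<le> p\<^sup>*\<^sub>s\<close> is a reformulation of this inequality. For \<open>s p \<ge> N\<close> it is immediate, including the value \<open>q = \<infinity>\<close>,
  which is admissible only then.
\<close>

lemma admissible_exponent_nonneg:
  assumes "1 \<le> p" "0 < s" "admissible N p s q"
  shows "0 \<le> s * p - real N + real N * exp_ratio p q"
proof (cases "real N \<le> s * p")
  case True
  then show ?thesis
    using assms(1) by (simp add: exp_ratio_def)
next
  case False
  then have q: "ennreal p \<le> q" "q \<le> ennreal (sobolev_exp N p s)"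
    using assms(3) by (auto simp: admissible_def)
  then obtain r where r: "q = ennreal r" "0 \<le> r"
    by (cases q) (auto simp: top_unique)
  have "0 \<le> sobolev_exp N p s"
    using False assms(1) by (simp add: sobolev_exp_def)
  with q r assms(1) have "p \<le> r" "r \<le> real N * p / (real N - s * p)"
    by (auto simp: sobolev_exp_def)
  then have "real N - s * p \<le> real N * p / r"
    using False assms(1) by (simp add: field_simps)
  then show ?thesis
    using r by (simp add: exp_ratio_def)
qed

lemma admissible_ge_1:
  assumes "1 \<le> p" "admissible N p s q"
  shows "1 \<le> q"
proof -
  have "1 \<le> ennreal p"
    using assms(1) by (simp add: ennreal_ge_1)
  also have "ennreal p \<le> q"
    using assms(2) by (simp add: admissible_def)
  finally show ?thesis .
qed

text \<open>
  The factor \<open>(2 sqrt N)\<^sup>N\<close> pays for the average over the small ball, and \<open>2 powr p\<close> for replacing \<open>1 - \<rho>\<close> by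
  \<open>(1 - sqrt N r / R) / 2\<close>.
\<close>

definition deviation_weight :: "nat \<Rightarrow> real \<Rightarrow> real \<Rightarrow> real \<Rightarrow> real" where
  "deviation_weight N p s t =
    shape_const N p * (2 * sqrt N) ^ N * 2 powr p * (1 - sqrt N / t) powr - (s * p)"

lemma deviation_weight_const_pos:
  assumes "1 \<le> p" "0 < N"
  shows "0 < shape_const N p * (2 * sqrt N) ^ N * 2 powr p"
proof -
  have "0 < shape_const N p"
    unfolding shape_const_def using assms by (intro mult_pos_pos add_pos_nonneg mult_nonneg_nonneg) auto
  then show ?thesis
    using assms by simp
qed

text \<open>
  The scaling factor \<open>\<sigma>\<close> cancels. Infinite values of \<open>g\<close> and the value \<open>\<Lambda> = 0\<close> are covered by the conventions
  of extended arithmetic.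
\<close>

lemma ennreal_quotient_regroup:
  fixes a :: real and \<Lambda> g :: ennreal
  assumes "0 \<le> a" "0 < \<sigma>"
  shows "ennreal a * (g / \<Lambda>) \<le> (ennreal a / (ennreal \<sigma> * \<Lambda>)) * (ennreal \<sigma> * g)"
proof (cases \<Lambda>)
  case (real l)
  show ?thesis
  proof (cases "l = 0")
    case True
    then show ?thesis
      using assms real by (auto simp: divide_ennreal_def ennreal_mult_top ennreal_top_mult zero_less_mult_iff)
  next
    case False
    then have "0 < l"
      using real by simp
    then have "ennreal a / (ennreal \<sigma> * \<Lambda>) = ennreal (a / (\<sigma> * l))"
      using assms by (simp add: real divide_ennreal flip: ennreal_mult')
    then have "(ennreal a / (ennreal \<sigma> * \<Lambda>)) * (ennreal \<sigma> * g) = ennreal (a / (\<sigma> * l)) * ennreal \<sigma> * g"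
      by (simp only: mult.assoc)
    also have "ennreal (a / (\<sigma> * l)) * ennreal \<sigma> = ennreal (a / (\<sigma> * l) * \<sigma>)"
      using assms \<open>0 < l\<close> by (subst ennreal_mult') auto
    also have "a / (\<sigma> * l) * \<sigma> = a * (1 / l)"
      using assms by simp
    finally have "(ennreal a / (ennreal \<sigma> * \<Lambda>)) * (ennreal \<sigma> * g) = ennreal a * (ennreal (1 / l) * g)"
      using assms by (simp only: ennreal_mult' mult.assoc)
    moreover have "g / \<Lambda> = ennreal (1 / l) * g"
      using \<open>0 < l\<close> by (simp add: real divide_ennreal_def inverse_ennreal inverse_eq_divide mult.commute)
    ultimately show ?thesis
      by simp
  qed
qed (simp add: ennreal_divide_top)

text \<open>
  Dilation to the unit ball. The radius \<open>R\<close> is first replaced by \<open>R' = min R (2 sqrt N r)\<close>, so that the ratio of the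
  radii stays bounded; both the seminorm over the ball and, by admissibility, the power of the radius
  increase when \<open>R'\<close> is raised to \<open>R\<close> again.
\<close>

lemma deviation_le_weighted_gagliardo:
  fixes u :: "'a::euclidean_space \<Rightarrow> real"
  defines "N \<equiv> DIM('a)"
  assumes p: "1 \<le> p" and s: "0 < s" "s < 1" and adm: "admissible N p s q"
    and u: "\<And>k. Ck k u" and r: "0 < r" "sqrt N * r < R"
  shows "ennpowr (Lq_norm q (ball x0 r) (\<lambda>x. u x - av u (ball x0 r))) p
    \<le> ennreal (deviation_weight N p s (R / r)) *
       (ennreal (R powr (s * p - real N + real N * exp_ratio p q)) /
         (ennreal (s * (1 - s)) * lam s p q (ball (0 :: 'a) 1))) *
       (ennreal (s * (1 - s)) * gagliardo s p (ball x0 R) UNIV u)"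
proof -
  define e where "e = s * p - real N + real N * exp_ratio p q"
  define \<Lambda> where "\<Lambda> = lam s p q (ball (0 :: 'a) 1)"
  define g where "g = gagliardo s p (ball x0 R) UNIV u"
  have q: "1 \<le> q"
    using p adm by (rule admissible_ge_1)
  have e: "0 \<le> e"
    unfolding e_def using p s adm by (intro admissible_exponent_nonneg) auto
  have "1 \<le> N"
    by (simp add: N_def Suc_le_eq)
  then have N: "1 \<le> sqrt N"
    by simp
  define R' where "R' = min R (2 * sqrt N * r)"
  define \<rho> where "\<rho> = r / R'"
  have "1 * r \<le> sqrt N * r"
    by (rule mult_right_mono[OF N]) (use r in simp)
  then have rR: "r < R" "r < 2 * sqrt N * r" "sqrt N * r < 2 * sqrt N * r"
    using r by linarith+
  then have R': "0 < R'" "R' \<le> R" "r < R'" "sqrt N * r < R'" "R' \<le> 2 * sqrt N * r"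
    using r by (auto simp: R'_def)
  then have \<rho>: "0 < \<rho>" "\<rho> < 1" "R' * \<rho> = r"
    using r by (auto simp: \<rho>_def)
  define v where "v x = u (x0 + R' *\<^sub>R x)" for x
  have v: "Ck k v" for k
    unfolding v_def[abs_def] by (rule Ck_affine[OF u])
  have [measurable]: "u \<in> borel_measurable borel"
    using u[of 0] by (intro borel_measurable_continuous_onI) simp
  have av_v: "av v (ball 0 \<rho>) = av u (ball x0 r)"
    unfolding v_def \<rho>(3)[symmetric] by (rule av_rescale) (use R' \<rho> in auto)
  define K where "K = shape_const N p * (1 / \<rho> ^ N) * (1 - \<rho>) powr - (s * p)"
  have sc: "0 \<le> shape_const N p"
    unfolding shape_const_def using p by (intro mult_nonneg_nonneg add_nonneg_nonneg) auto
  have K: "0 \<le> K"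
    unfolding K_def using sc \<rho> by simp
  have K_le: "K \<le> deviation_weight N p s (R / r)"
  proof -
    have "1 / \<rho> \<le> 2 * sqrt N"
      using R' r by (simp add: \<rho>_def field_simps)
    then have "(1 / \<rho>) ^ N \<le> (2 * sqrt N) ^ N"
      using \<rho> by (intro power_mono) auto
    then have 1: "1 / \<rho> ^ N \<le> (2 * sqrt N) ^ N"
      by (simp add: power_divide)
    define z where "z = 1 - sqrt N / (R / r)"
    have z: "0 < z" "z \<le> 1"
      using r rR by (auto simp: z_def field_simps)
    \<comment> \<open>Without truncation \<open>z = 1 - sqrt N \<rho>\<close>; after truncation \<open>sqrt N \<rho> = 1 / 2\<close> and \<open>z \<le> 1\<close> suffices.\<close>
    have "z / 2 \<le> 1 - \<rho>"
    proof -
      have "z / 2 \<le> 1 - sqrt N * \<rho>"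
      proof (cases "R \<le> 2 * sqrt N * r")
        case True
        then have "R' = R" by (simp add: R'_def)
        then have "z = 1 - sqrt N * \<rho>"
          by (simp add: z_def \<rho>_def)
        then show ?thesis
          using z(1) by linarith
      next
        case False
        then have "R' = 2 * sqrt N * r" by (simp add: R'_def)
        then have "sqrt N * \<rho> = 1 / 2"
          using N r by (simp add: \<rho>_def)
        then show ?thesis
          using z by simp
      qed
      also have "\<dots> \<le> 1 - 1 * \<rho>"
        using N \<rho> by (intro diff_left_mono mult_right_mono) auto
      finally show ?thesis by simp
    qed
    then have "(1 - \<rho>) powr - (s * p) \<le> (z / 2) powr - (s * p)"
      using z s p by (intro powr_mono2') auto
    also have "\<dots> = 2 powr (s * p) * z powr - (s * p)"
      using z by (simp add: powr_divide powr_minus_divide)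
    also have "\<dots> \<le> 2 powr p * z powr - (s * p)"
      using s p by (intro mult_right_mono powr_mono) auto
    finally have 2: "(1 - \<rho>) powr - (s * p) \<le> 2 powr p * z powr - (s * p)" .
    have "K \<le> shape_const N p * (2 * sqrt N) ^ N * (2 powr p * z powr - (s * p))"
      unfolding K_def using 1 2 sc \<rho> by (intro mult_mono mult_left_mono) auto
    then show ?thesis
      by (simp add: deviation_weight_def z_def mult.assoc)
  qed
  have "Lq_norm q (ball x0 r) (\<lambda>x. u x - av u (ball x0 r))
      \<le> ennreal (R' powr exp_ratio (real N) q) * Lq_norm q (ball 0 \<rho>) (\<lambda>x. v x - av v (ball 0 \<rho>))"
    unfolding av_v unfolding v_def N_def \<rho>(3)[symmetric] by (rule Lq_norm_rescale) (use R' in auto)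
  then have "ennpowr (Lq_norm q (ball x0 r) (\<lambda>x. u x - av u (ball x0 r))) p
      \<le> ennpowr (ennreal (R' powr exp_ratio (real N) q) * Lq_norm q (ball 0 \<rho>) (\<lambda>x. v x - av v (ball 0 \<rho>))) p"
    using p by (intro ennpowr_mono) auto
  also have "\<dots> = ennreal ((R' powr exp_ratio (real N) q) powr p)
      * ennpowr (Lq_norm q (ball 0 \<rho>) (\<lambda>x. v x - av v (ball 0 \<rho>))) p"
    using R' by (intro ennpowr_cmult) simp
  also have "\<dots> \<le> ennreal ((R' powr exp_ratio (real N) q) powr p)
      * (ennreal K * (gagliardo s p (ball 0 1) UNIV v / \<Lambda>))"
    unfolding K_def \<Lambda>_def N_def
    by (intro mult_left_mono sobolev_deviation_unit_ball v \<rho> p s q) simp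
  also have "gagliardo s p (ball 0 1) UNIV v = ennreal (R' powr (s * p - real N)) * gagliardo s p (ball x0 R') UNIV u"
    unfolding v_def N_def by (rule gagliardo_rescale) (use R' in auto)
  also have "ennreal ((R' powr exp_ratio (real N) q) powr p)
      * (ennreal K * (ennreal (R' powr (s * p - real N)) * gagliardo s p (ball x0 R') UNIV u / \<Lambda>))
      = ennreal K * ((ennreal ((R' powr exp_ratio (real N) q) powr p) * ennreal (R' powr (s * p - real N)))
        * (gagliardo s p (ball x0 R') UNIV u / \<Lambda>))"
    by (simp add: divide_ennreal_def mult_ac)
  also have "ennreal ((R' powr exp_ratio (real N) q) powr p) * ennreal (R' powr (s * p - real N)) = ennreal (R' powr e)"
    using R' by (subst ennreal_mult'[symmetric])
      (auto simp: powr_powr e_def exp_ratio_def add_ac simp flip: powr_add)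
  also have "ennreal K * (ennreal (R' powr e) * (gagliardo s p (ball x0 R') UNIV u / \<Lambda>))
      \<le> ennreal (deviation_weight N p s (R / r)) * (ennreal (R powr e) * (g / \<Lambda>))"
    unfolding g_def using R' e K_le
    by (intro mult_mono ennreal_leI powr_mono2 divide_right_mono_ennreal gagliardo_mono subset_ball) auto
  also have "\<dots> \<le> ennreal (deviation_weight N p s (R / r)) *
      ((ennreal (R powr e) / (ennreal (s * (1 - s)) * \<Lambda>)) * (ennreal (s * (1 - s)) * g))"
    using s by (intro mult_left_mono ennreal_quotient_regroup) auto
  finally show ?thesis
    unfolding e_def \<Lambda>_def g_def by (simp only: mult.assoc)
qed

lemma deviation_weight_limits:
  fixes N :: nat
  assumes p: "1 \<le> p" and N: "0 < N"
  shows "sqrt N < t \<Longrightarrow> \<exists>L>0. ((\<lambda>s. deviation_weight N p s t) \<longlongrightarrow> L) (at_right 0)"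
    and "sqrt N < t \<Longrightarrow> \<exists>L>0. ((\<lambda>s. deviation_weight N p s t) \<longlongrightarrow> L) (at_left 1)"
    and "\<exists>L>0. ((\<lambda>t. (t - sqrt N) powr (s * p) * deviation_weight N p s t) \<longlongrightarrow> L) (at_right (sqrt N))"
    and "\<exists>L>0. ((\<lambda>t. deviation_weight N p s t) \<longlongrightarrow> L) at_top"
proof -
  define C where "C = shape_const N p * (2 * sqrt N) ^ N * 2 powr p"
  have C: "0 < C"
    unfolding C_def using p N by (rule deviation_weight_const_pos)
  have W: "deviation_weight N p s t = C * (1 - sqrt N / t) powr - (s * p)" for s t
    by (simp add: deviation_weight_def C_def)
  have z: "0 < 1 - sqrt N / t" if "sqrt N < t" for t
  proof -
    have "0 < t" using that real_sqrt_ge_zero[of "real N"] by linarith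
    then show ?thesis using that by (simp add: field_simps)
  qed
  have pos: "0 < C * (1 - sqrt N / t) powr a" if "sqrt N < t" for t a
    using C z[OF that] by (intro mult_pos_pos) (simp_all only: powr_gt_zero less_imp_neq[symmetric] not_False_eq_True)
  show "\<exists>L>0. ((\<lambda>s. deviation_weight N p s t) \<longlongrightarrow> L) (at_right 0)" if "sqrt N < t"
  proof (intro exI conjI)
    show "((\<lambda>s. deviation_weight N p s t) \<longlongrightarrow> C * (1 - sqrt N / t) powr - (0 * p)) (at_right 0)"
      unfolding W using z[OF that] that N by (intro tendsto_intros) auto
  qed (rule pos[OF that])
  show "\<exists>L>0. ((\<lambda>s. deviation_weight N p s t) \<longlongrightarrow> L) (at_left 1)" if "sqrt N < t"
  proof (intro exI conjI)
    show "((\<lambda>s. deviation_weight N p s t) \<longlongrightarrow> C * (1 - sqrt N / t) powr - (1 * p)) (at_left 1)"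
      unfolding W using z[OF that] that N by (intro tendsto_intros) auto
  qed (rule pos[OF that])
  show "\<exists>L>0. ((\<lambda>t. (t - sqrt N) powr (s * p) * deviation_weight N p s t) \<longlongrightarrow> L) (at_right (sqrt N))"
  proof (intro exI conjI)
    have "((\<lambda>t. C * t powr (s * p)) \<longlongrightarrow> C * sqrt N powr (s * p)) (at_right (sqrt N))"
      using N by (intro tendsto_intros) auto
    then show "((\<lambda>t. (t - sqrt N) powr (s * p) * deviation_weight N p s t) \<longlongrightarrow> C * sqrt N powr (s * p)) (at_right (sqrt N))"
    proof (rule Lim_transform_eventually)
      show "\<forall>\<^sub>F t in at_right (sqrt N). C * t powr (s * p) = (t - sqrt N) powr (s * p) * deviation_weight N p s t"
        unfolding eventually_at_filter
      proof (intro always_eventually allI impI)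
        fix t assume "t \<noteq> sqrt N" "t \<in> {sqrt N<..}"
        then have "sqrt N < t"
          by simp
        moreover from this have "0 < t"
          using real_sqrt_ge_zero[of "real N"] by linarith
        ultimately have t: "sqrt N < t" "0 < t" .
        then have "1 - sqrt N / t = (t - sqrt N) / t"
          by (simp add: field_simps)
        then show "C * t powr (s * p) = (t - sqrt N) powr (s * p) * deviation_weight N p s t"
          using t by (simp add: W powr_divide powr_minus_divide)
      qed
    qed
  qed (use C N in simp)
  show "\<exists>L>0. ((\<lambda>t. deviation_weight N p s t) \<longlongrightarrow> L) at_top"
  proof (intro exI conjI)
    have "((\<lambda>t. sqrt N / t) \<longlongrightarrow> 0) at_top"
      by (intro tendsto_divide_0[OF tendsto_const] filterlim_at_top_imp_at_infinity filterlim_ident)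
    then show "((\<lambda>t. deviation_weight N p s t) \<longlongrightarrow> C * (1 - 0) powr - (s * p)) at_top"
      unfolding W by (intro tendsto_intros) auto
  qed (use C in simp)
qed

theorem lemma4p9:
  defines "N \<equiv> CARD('n::finite)"
  shows "\<exists>W :: real \<Rightarrow> real \<Rightarrow> ennreal \<Rightarrow> real \<Rightarrow> real.
    (\<forall>p s q t. 1 \<le> p \<and> 0 < s \<and> s < 1 \<and> admissible N p s q \<and> sqrt N < t \<longrightarrow> 0 < W p s q t) \<and>
    (\<forall>p s q. 1 \<le> p \<and> 0 < s \<and> s < 1 \<and> admissible N p s q \<longrightarrow>
      (\<forall>(x0 :: real ^ 'n) r R. \<forall>u \<in> test_functions UNIV. 0 < r \<and> sqrt N * r < R \<longrightarrow>
        ennpowr (Lq_norm q (ball x0 r) (\<lambda>x. u x - av u (ball x0 r))) p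
        \<le> ennreal (W p s q (R / r)) *
           (ennreal (R powr (s * p - real N + real N * exp_ratio p q)) /
             (ennreal (s * (1 - s)) * lam s p q (ball (0 :: real ^ 'n) 1))) *
           (ennreal (s * (1 - s)) * gagliardo s p (ball x0 R) UNIV u))) \<and>
    (\<forall>p t. 1 \<le> p \<and> sqrt N < t \<longrightarrow>
      (\<forall>Q. (\<forall>\<^sub>F s in at_right 0. admissible N p s (Q s)) \<longrightarrow>
        (\<exists>L>0. ((\<lambda>s. W p s (Q s) t) \<longlongrightarrow> L) (at_right 0))) \<and>
      (\<forall>Q q. (\<forall>\<^sub>F s in at_left 1. admissible N p s (Q s)) \<and> (Q \<longlongrightarrow> q) (at_left 1) \<longrightarrow>
        (\<exists>L>0. ((\<lambda>s. W p s (Q s) t) \<longlongrightarrow> L) (at_left 1)))) \<and>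
    (\<forall>p s q. 1 \<le> p \<and> 0 < s \<and> s < 1 \<and> admissible N p s q \<longrightarrow>
      (\<exists>L>0. ((\<lambda>t. (t - sqrt N) powr (s * p) * W p s q t) \<longlongrightarrow> L) (at_right (sqrt N))) \<and>
      (\<exists>L>0. ((\<lambda>t. W p s q t) \<longlongrightarrow> L) at_top))"
proof -
  have N_pos: "0 < N"
    by (simp add: N_def)
  have N_dim: "N = DIM(real ^ 'n)"
    by (simp add: N_def)
  have weight_pos: "0 < deviation_weight N p s t" if "1 \<le> p" "sqrt N < t" for p s t :: real
  proof -
    have "0 < t"
      using that(2) real_sqrt_ge_zero[of "real N"] by linarith
    then have "0 < 1 - sqrt N / t"
      using that(2) by (simp add: field_simps)
    then have "0 < (1 - sqrt N / t) powr - (s * p)"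
      by (simp only: powr_gt_zero less_imp_neq[symmetric] not_False_eq_True)
    then show ?thesis
      unfolding deviation_weight_def
      by (rule mult_pos_pos[OF deviation_weight_const_pos[OF that(1) N_pos]])
  qed
  have inequality: "ennpowr (Lq_norm q (ball x0 r) (\<lambda>x. u x - av u (ball x0 r))) p
        \<le> ennreal (deviation_weight N p s (R / r)) *
           (ennreal (R powr (s * p - real N + real N * exp_ratio p q)) /
             (ennreal (s * (1 - s)) * lam s p q (ball (0 :: real ^ 'n) 1))) *
           (ennreal (s * (1 - s)) * gagliardo s p (ball x0 R) UNIV u)"
    if "1 \<le> p" "0 < s" "s < 1" "admissible N p s q" "u \<in> test_functions UNIV" "0 < r" "sqrt N * r < R"
    for p s q r R u and x0 :: "real ^ 'n"
    unfolding N_dim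
    by (rule deviation_le_weighted_gagliardo) (use that in \<open>auto simp: N_dim test_functions_def\<close>)
  show ?thesis
    by (rule exI[of _ "\<lambda>p s q t. deviation_weight N p s t"])
      (use weight_pos inequality deviation_weight_limits[OF _ N_pos] in blast)
qed

end
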